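(* Let $1\le p<+\infty$, let $X$ be a finite dimensional Banach space over $\mathbb K\in\{\mathbb R,\mathbb C\}$, let $\mathcal S=(S_n)_{n\in\mathbb Z}$ be a sequence of invertible linear operators on $X$ for which there is $C_0>0$ with $\|S_n\|,\|S_n^{-1}\|<C_0$ for all $n\in\mathbb Z$, and let $\mathcal E$ be a basis of $X$ with $\mathcal S$-bounded projections. Then the shift operator $\sigma_{\mathcal S}\colon\ell_p(X)\to\ell_p(X)$ is generalized hyperbolic if and only if it has the shadowing property.
   Context: $\ell_p(X)$ is the Banach space of bilateral sequences $(y_n)_{n\in\mathbb Z}$ in $X$ with $\|(y_n)\|_p=(\sum_{n\in\mathbb Z}\|y_n\|^p)^{1/p}<\infty$. Shift operator: $\sigma_{\mathcal S}((x_n)_{n\in\mathbb Z})=(S_{n+1}(x_{n+1}))_{n\in\mathbb Z}$. For $n,m\in\mathbb Z$ let $S_{[n,m]}=S_n\circ S_{n+1}\circ\cdots\circ S_m$ if $n<m$, $S_{[n,n]}=S_n$, and $S_{[n,m]}=\mathrm{Id}$ if $n>m$. For $x\in X\setminus\{0\}$ define the unit vectors $$e_n(x)=\frac{(S_{[1,n]})^{-1}(x)}{\|(S_{[1,n]})^{-1}(x)\|}\ (n\ge0),\qquad e_n(x)=\frac{S_{[n+1,0]}(x)}{\|S_{[n+1,0]}(x)\|}\ (n<0).$$ $\mathcal S$-bounded projections: for a basis $\mathcal E$ of $X$ put $\mathcal E_n=\{e_n(x)\colon x\in\mathcal E\}$, which is a basis of $X$ for each $n\in\mathbb Z$. For $b\in\mathcal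 E_n$ let $\Pi_b\colon X\to\mathrm{span}\{b\}$, $\Pi_b(\sum_{c\in\mathcal E_n}\alpha_c c)=\alpha_b b$. The basis $\mathcal E$ has $\mathcal S$-bounded projections if $\sup_{n\in\mathbb Z}\sup_{b\in\mathcal E_n}\|\Pi_b\|<+\infty$. For a bounded invertible linear operator $T$ on a Banach space $Y$: $T$ has the shadowing property if there is $K>0$ such that for every bounded sequence $(z_n)_{n\in\mathbb Z}$ in $Y$ there is a bounded sequence $(x_n)_{n\in\mathbb Z}$ in $Y$ with $x_{n+1}-T(x_n)=z_n$ for all $n$ and $\sup_n\|x_n\|\le K\sup_n\|z_n\|$. $T$ is generalized hyperbolic if $Y=M\oplus N$ with $M,N$ closed subspaces, $T(M)\subset M$, $T^{-1}(N)\subset N$, and the spectral radii $\lim_n\|(T|_M)^n\|^{1/n}$ and $\lim_n\|(T^{-1}|_N)^n\|^{1/n}$ are both $<1$. *)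

theory Defs
  imports "HOL-Analysis.Analysis" "HOL-Library.Function_Algebras"
begin

section \<open>Scalars and normed spaces\<close>

text \<open>The scalar fields are \<open>\<real>\<close> and \<open>\<complex>\<close>, each up to an isometric field isomorphism (a
  multiplicative isometry sends \<open>1\<close> to \<open>1\<close>).\<close>

class real_or_complex = real_normed_field +
  assumes ex_isometric_embedding_complex:
    "\<exists>f :: 'a \<Rightarrow> complex. (\<forall>a b. f (a + b) = f a + f b) \<and> (\<forall>a b. f (a * b) = f a * f b) \<and>
       (\<forall>a. cmod (f a) = norm a) \<and> (range f = \<real> \<or> range f = UNIV)"

instance real :: real_or_complex
  by standard (rule exI[of _ complex_of_real], auto simp: Reals_def)

instance complex :: real_or_complex
  by standard (rule exI[of _ "\<lambda>z. z"], auto)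

text \<open>The norm and topology come from the type class of \<^typ>\<open>'a\<close>; the \<open>\<bbbK>\<close>-linear structure is
  the explicit scalar multiplication, which extends the real one of the type class.\<close>

locale normed_space_over = vector_space scl
  for scl :: "'k::real_or_complex \<Rightarrow> 'a::real_normed_vector \<Rightarrow> 'a" +
  assumes norm_scale: "norm (scl c x) = norm c * norm x"
    and scale_of_real: "scl (of_real r) x = r *\<^sub>R x"

definition finite_dimensional :: "('k::field \<Rightarrow> 'a::ab_group_add \<Rightarrow> 'a) \<Rightarrow> bool" where
  "finite_dimensional scl \<longleftrightarrow> (\<exists>B. finite B \<and> module.span scl B = UNIV)"

definition is_basis :: "('k::field \<Rightarrow> 'a::ab_group_add \<Rightarrow> 'a) \<Rightarrow> 'a set \<Rightarrow> bool" where
  "is_basis scl B \<longleftrightarrow> \<not> module.dependent scl B \<and> module.span scl B = UNIV"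

text \<open>Boundedness of \<open>T\<close> and of its inverse is part of the definition because \<^const>\<open>onorm\<close> is the
  operator norm only for bounded operators; in finite dimension it is automatic.\<close>

definition invertible_operator ::
    "('k::field \<Rightarrow> 'a::real_normed_vector \<Rightarrow> 'a) \<Rightarrow> ('a \<Rightarrow> 'a) \<Rightarrow> bool" where
  "invertible_operator scl T \<longleftrightarrow>
     Vector_Spaces.linear scl scl T \<and> bij T \<and> bounded_linear T \<and> bounded_linear (inv T)"


section \<open>Bounded projections\<close>

text \<open>\<open>S n \<circ> S (n + 1) \<circ> \<dots> \<circ> S m\<close>; the list \<open>[n..m]\<close> is empty for \<open>n > m\<close>.\<close>

definition comp_seg :: "(int \<Rightarrow> 'a \<Rightarrow> 'a) \<Rightarrow> int \<Rightarrow> int \<Rightarrow> 'a \<Rightarrow> 'a" where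
  "comp_seg S n m = foldr (\<circ>) (map S [n..m]) id"

definition unit_orbit :: "(int \<Rightarrow> 'a \<Rightarrow> 'a) \<Rightarrow> int \<Rightarrow> 'a \<Rightarrow> 'a::real_normed_vector" where
  "unit_orbit S n x =
     (if n \<ge> 0 then inv (comp_seg S 1 n) x /\<^sub>R norm (inv (comp_seg S 1 n) x)
      else comp_seg S (n + 1) 0 x /\<^sub>R norm (comp_seg S (n + 1) 0 x))"

definition basis_at :: "(int \<Rightarrow> 'a \<Rightarrow> 'a) \<Rightarrow> 'a set \<Rightarrow> int \<Rightarrow> 'a::real_normed_vector set" where
  "basis_at S E n = unit_orbit S n ` E"

definition basis_proj ::
    "('k::field \<Rightarrow> 'a::ab_group_add \<Rightarrow> 'a) \<Rightarrow> 'a set \<Rightarrow> 'a \<Rightarrow> 'a \<Rightarrow> 'a" where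
  "basis_proj scl B b x = scl (module.representation scl B x b) b"

definition has_bounded_projections ::
    "('k::field \<Rightarrow> 'a::real_normed_vector \<Rightarrow> 'a) \<Rightarrow> (int \<Rightarrow> 'a \<Rightarrow> 'a) \<Rightarrow> 'a set \<Rightarrow> bool" where
  "has_bounded_projections scl S E \<longleftrightarrow>
     (\<exists>C. \<forall>n. \<forall>b \<in> basis_at S E n.
        bounded_linear (basis_proj scl (basis_at S E n) b) \<and>
        onorm (basis_proj scl (basis_at S E n) b) \<le> C)"


section \<open>Shadowing and generalized hyperbolicity\<close>

text \<open>A normed space \<open>Y\<close> is given here by a carrier set \<open>Y\<close>, a norm \<open>nrm\<close> on it and, where
  needed, a scalar multiplication \<open>scl\<close>; \<open>T\<close> is meant to be a bounded invertible linear operator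
  on \<open>Y\<close>.\<close>

definition bounded_seq_in :: "'v set \<Rightarrow> ('v \<Rightarrow> real) \<Rightarrow> (int \<Rightarrow> 'v) \<Rightarrow> bool" where
  "bounded_seq_in Y nrm z \<longleftrightarrow> range z \<subseteq> Y \<and> bdd_above (range (\<lambda>n. nrm (z n)))"

definition shadowing_property ::
    "'v::ab_group_add set \<Rightarrow> ('v \<Rightarrow> real) \<Rightarrow> ('v \<Rightarrow> 'v) \<Rightarrow> bool" where
  "shadowing_property Y nrm T \<longleftrightarrow>
     (\<exists>K>0. \<forall>z. bounded_seq_in Y nrm z \<longrightarrow>
        (\<exists>x. bounded_seq_in Y nrm x \<and> (\<forall>n. x (n + 1) - T (x n) = z n) \<and>
             (SUP n. nrm (x n)) \<le> K * (SUP n. nrm (z n))))"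

definition closed_subspace ::
    "('k::field \<Rightarrow> 'v::ab_group_add \<Rightarrow> 'v) \<Rightarrow> 'v set \<Rightarrow> ('v \<Rightarrow> real) \<Rightarrow> 'v set \<Rightarrow> bool" where
  "closed_subspace scl Y nrm M \<longleftrightarrow>
     module.subspace scl M \<and> closedin (Metric_space.mtopology Y (\<lambda>x y. nrm (x - y))) M"

text \<open>The operator norm of the restriction of \<open>A\<close> to the subspace \<open>M\<close>, for \<open>A\<close> bounded on \<open>M\<close>.\<close>

definition restr_onorm :: "('v \<Rightarrow> real) \<Rightarrow> 'v set \<Rightarrow> ('v \<Rightarrow> 'v) \<Rightarrow> real" where
  "restr_onorm nrm M A = Sup {nrm (A y) |y. y \<in> M \<and> nrm y \<le> 1}"

definition has_spectral_radius_on ::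
    "('v \<Rightarrow> real) \<Rightarrow> 'v set \<Rightarrow> ('v \<Rightarrow> 'v) \<Rightarrow> real \<Rightarrow> bool" where
  "has_spectral_radius_on nrm M A r \<longleftrightarrow>
     (\<lambda>n. root n (restr_onorm nrm M (A ^^ n))) \<longlonglongrightarrow> r"

definition generalized_hyperbolic ::
    "('k::field \<Rightarrow> 'v::ab_group_add \<Rightarrow> 'v) \<Rightarrow> 'v set \<Rightarrow> ('v \<Rightarrow> real) \<Rightarrow> ('v \<Rightarrow> 'v) \<Rightarrow> bool" where
  "generalized_hyperbolic scl Y nrm T \<longleftrightarrow>
     (\<exists>M N. closed_subspace scl Y nrm M \<and> closed_subspace scl Y nrm N \<and>
        M \<inter> N = {0} \<and> {u + v |u v. u \<in> M \<and> v \<in> N} = Y \<and>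
        T ` M \<subseteq> M \<and> inv_into Y T ` N \<subseteq> N \<and>
        (\<exists>r<1. has_spectral_radius_on nrm M T r) \<and>
        (\<exists>r<1. has_spectral_radius_on nrm N (inv_into Y T) r))"


section \<open>The shift operator on bilateral \<open>p\<close>-summable sequences\<close>

definition lp_space :: "real \<Rightarrow> (int \<Rightarrow> 'a::real_normed_vector) set" where
  "lp_space p = {y. (\<lambda>n. norm (y n) powr p) summable_on UNIV}"

definition lp_norm :: "real \<Rightarrow> (int \<Rightarrow> 'a::real_normed_vector) \<Rightarrow> real" where
  "lp_norm p y = (\<Sum>\<^sub>\<infinity>n\<in>UNIV. norm (y n) powr p) powr (1 / p)"

definition seq_scale :: "('k \<Rightarrow> 'a \<Rightarrow> 'a) \<Rightarrow> 'k \<Rightarrow> (int \<Rightarrow> 'a) \<Rightarrow> int \<Rightarrow> 'a" where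
  "seq_scale scl c y = (\<lambda>n. scl c (y n))"

definition shift_op :: "(int \<Rightarrow> 'a \<Rightarrow> 'a) \<Rightarrow> (int \<Rightarrow> 'a) \<Rightarrow> int \<Rightarrow> 'a" where
  "shift_op S x = (\<lambda>n. S (n + 1) (x (n + 1)))"

end

theory Submission
  imports Defs
begin

text \<open>Both properties are compared with a third one, an exponential splitting: a decomposition of
\<open>\<ell>\<^sub>p(X)\<close> into closed subspaces \<open>M\<close> and \<open>N\<close>, where \<open>\<sigma>\<close> maps \<open>M\<close> into itself and its
powers decay on \<open>M\<close> like \<open>C \<theta>\<^sup>n\<close> with \<open>\<theta> < 1\<close>, and the same holds for \<open>\<sigma>\<close>'s inverse on \<open>N\<close>.

An exponential splitting is the same as generalized hyperbolicity
(\<open>generalized_hyperbolic_iff_splitting\<close>). The operator norms of the powers form a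
submultiplicative sequence, so by Fekete's argument their \<open>n\<close>-th roots converge to their
infimum, and this limit is below \<open>1\<close> exactly if the powers decay geometrically.

A splitting gives shadowing (\<open>exponential_splitting_imp_shadowing\<close>): write \<open>z\<^sub>n = u\<^sub>n + v\<^sub>n\<close> with
\<open>u\<^sub>n\<close> in \<open>M\<close> and \<open>v\<^sub>n\<close> in \<open>N\<close>, transport the \<open>u\<^sub>k\<close> forward in time and the \<open>v\<^sub>k\<close> backward; the
two resulting series converge geometrically and their difference solves the equation. The norms
of \<open>u\<^sub>n\<close> and \<open>v\<^sub>n\<close> have to be bounded by that of \<open>z\<^sub>n\<close>, which is an open mapping theorem
(\<open>bounded_decomposition\<close>) and follows from the Baire category theorem.

Shadowing gives a splitting (\<open>shadowing_imp_splitting\<close>). Along each basis vector \<open>b\<close>, the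
operators \<open>S\<^sub>j\<close> multiply by positive numbers \<open>g\<^sub>j\<^sub>-\<^sub>1 / g\<^sub>j\<close>, where \<open>g\<^sub>j\<close> is the norm of the vector
at position \<open>j\<close> on the orbit of \<open>b\<close>. Use as errors the unit vectors along this orbit, one at each
time, moving with the shift. Reading the solution along the same diagonal and taking the
coordinate at \<open>b\<close> gives bounded scalars \<open>a\<^sub>j\<close> with \<open>a\<^sub>j\<^sub>-\<^sub>1 = (g\<^sub>j\<^sub>-\<^sub>1 / g\<^sub>j) a\<^sub>j + 1\<close>. The sign of
the real part of \<open>a\<^sub>j\<close> decides everything (\<open>scalar_dichotomy\<close>): positivity persists as \<open>j\<close>
decreases. A positive bounded solution that gains \<open>1\<close> at each step forces the multipliers to
contract, while a negative one forces them to expand, at uniform rates. Let \<open>M\<close> consist of the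
sequences whose \<open>b\<close>-component lives where this real part is positive, for every \<open>b\<close>, and \<open>N\<close> of those whose
\<open>b\<close>-component lives on the complement. The bounded projections turn the scalar estimates into
estimates for vectors and make \<open>M\<close> and \<open>N\<close> closed and complementary.\<close>

section \<open>The norm of p-summable sequences\<close>

lemma lp_norm_nonneg: "0 \<le> lp_norm p y"
  by (simp add: lp_norm_def)

lemma sum_powr_le_lp_norm:
  assumes "1 \<le> p" "y \<in> lp_space p" "finite F"
  shows "(\<Sum>n\<in>F. norm (y n) powr p) \<le> lp_norm p y powr p"
proof -
  have "(\<Sum>n\<in>F. norm (y n) powr p) \<le> (\<Sum>\<^sub>\<infinity>n\<in>UNIV. norm (y n) powr p)"
    using assms by (intro finite_sum_le_infsum) (auto simp: lp_space_def)
  also have "\<dots> = lp_norm p y powr p"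
    using assms(1) by (simp add: lp_norm_def powr_powr infsum_nonneg)
  finally show ?thesis .
qed

text \<open>Bounds on finite partial sums are stable under pointwise limits, so this criterion plays the role
of Fatou's lemma below.\<close>

lemma lp_boundedI:
  assumes "1 \<le> p" "0 \<le> B" "\<And>F. finite F \<Longrightarrow> (\<Sum>n\<in>F. norm (y n) powr p) \<le> B powr p"
  shows "y \<in> lp_space p" "lp_norm p y \<le> B"
proof -
  show y: "y \<in> lp_space p"
    unfolding lp_space_def
    by (auto intro!: nonneg_bdd_above_summable_on bdd_aboveI[of _ "B powr p"] assms(3))
  have "(\<Sum>\<^sub>\<infinity>n\<in>UNIV. norm (y n) powr p) \<le> B powr p"
    using y assms(3) by (intro infsum_le_finite_sums) (auto simp: lp_space_def)
  then have "lp_norm p y \<le> (B powr p) powr (1 / p)"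
    unfolding lp_norm_def using assms(1) by (intro powr_mono2) (auto intro: infsum_nonneg)
  also have "\<dots> = B"
    using assms by (simp add: powr_powr)
  finally show "lp_norm p y \<le> B" .
qed

lemma norm_le_lp_norm:
  assumes "1 \<le> p" "y \<in> lp_space p"
  shows "norm (y n) \<le> lp_norm p y"
proof -
  have "norm (y n) powr p \<le> lp_norm p y powr p"
    using sum_powr_le_lp_norm[OF assms, of "{n}"] by simp
  then show ?thesis
    using assms(1) lp_norm_nonneg[of p y] powr_less_mono2[of p "lp_norm p y" "norm (y n)"] by force
qed

text \<open>All operators that occur move entries by an injective change of position and act on each entry by
a bounded map; this lemma gives their norm bounds.\<close>

lemma lp_norm_dominated:
  assumes "1 \<le> p" "0 \<le> c" "inj \<pi>" "x \<in> lp_space p"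
    and "\<And>n. norm (y n) \<le> c * norm (x (\<pi> n))"
  shows "y \<in> lp_space p" "lp_norm p y \<le> c * lp_norm p x"
proof -
  have "(\<Sum>n\<in>F. norm (y n) powr p) \<le> (c * lp_norm p x) powr p" if "finite F" for F
  proof -
    have "(\<Sum>n\<in>F. norm (y n) powr p) \<le> (\<Sum>n\<in>F. c powr p * norm (x (\<pi> n)) powr p)"
    proof (rule sum_mono)
      fix n
      have "norm (y n) powr p \<le> (c * norm (x (\<pi> n))) powr p"
        using assms by (intro powr_mono2) auto
      then show "norm (y n) powr p \<le> c powr p * norm (x (\<pi> n)) powr p"
        using assms by (simp add: powr_mult)
    qed
    also have "\<dots> = c powr p * (\<Sum>m\<in>\<pi> ` F. norm (x m) powr p)"
      using inj_on_subset[OF assms(3) subset_UNIV, of F]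
      by (simp add: sum.reindex sum_distrib_left)
    also have "\<dots> \<le> c powr p * lp_norm p x powr p"
      using assms that by (intro mult_left_mono sum_powr_le_lp_norm) auto
    also have "\<dots> = (c * lp_norm p x) powr p"
      using assms by (simp add: powr_mult lp_norm_nonneg)
    finally show ?thesis .
  qed
  then show "y \<in> lp_space p" "lp_norm p y \<le> c * lp_norm p x"
    using assms(1,2) lp_norm_nonneg[of p x] by (blast intro: lp_boundedI mult_nonneg_nonneg)+
qed

lemma zero_in_lp_space [simp]: "0 \<in> lp_space p"
  by (simp add: lp_space_def zero_fun_def)

lemma lp_norm_zero [simp]: "lp_norm p 0 = 0"
  by (simp add: lp_norm_def zero_fun_def)

lemma lp_norm_eq_0_iff:
  assumes "1 \<le> p" "y \<in> lp_space p"
  shows "lp_norm p y = 0 \<longleftrightarrow> y = 0"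
proof
  assume "lp_norm p y = 0"
  then have "norm (y n) \<le> 0" for n
    using norm_le_lp_norm[OF assms, of n] by simp
  then show "y = 0"
    by (auto simp: fun_eq_iff)
qed auto

lemma lp_scaleR:
  assumes "1 \<le> p" "y \<in> lp_space p"
  shows "(\<lambda>n. r *\<^sub>R y n) \<in> lp_space p" "lp_norm p (\<lambda>n. r *\<^sub>R y n) = \<bar>r\<bar> * lp_norm p y"
proof -
  have le: "(\<lambda>n. s *\<^sub>R z n) \<in> lp_space p \<and> lp_norm p (\<lambda>n. s *\<^sub>R z n) \<le> \<bar>s\<bar> * lp_norm p z"
    if "z \<in> lp_space p" for s and z :: "int \<Rightarrow> 'a"
    using lp_norm_dominated[OF assms(1) _ inj_on_id that, of "\<bar>s\<bar>" "\<lambda>n. s *\<^sub>R z n"] by simp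
  show in_lp: "(\<lambda>n. r *\<^sub>R y n) \<in> lp_space p"
    using le assms(2) by blast
  show "lp_norm p (\<lambda>n. r *\<^sub>R y n) = \<bar>r\<bar> * lp_norm p y"
  proof (cases "r = 0")
    case True
    then show ?thesis
      using lp_norm_zero[of p, where 'a = 'a] by (simp add: zero_fun_def)
  next
    case False
    have "lp_norm p y \<le> \<bar>inverse r\<bar> * lp_norm p (\<lambda>n. r *\<^sub>R y n)"
      using le[OF in_lp, of "inverse r"] False by simp
    then have "\<bar>r\<bar> * lp_norm p y \<le> lp_norm p (\<lambda>n. r *\<^sub>R y n)"
      using False by (simp add: field_simps)
    then show ?thesis
      using le[OF assms(2), of r] by simp
  qed
qed

lemma lp_uminus:
  assumes "1 \<le> p" "y \<in> lp_space p"
  shows "- y \<in> lp_space p" "lp_norm p (- y) = lp_norm p y"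
  using lp_scaleR[OF assms, of "- 1"] by (simp_all add: fun_Compl_def)

text \<open>Convexity of the \<open>p\<close>-th power on the closed half-line. On the open half-line it is a derivative
test; if one argument vanishes, it says that weights in the unit interval satisfy \<open>a powr p \<le> a\<close>.\<close>

lemma convex_combination_powr_le:
  fixes s t :: real
  assumes "1 \<le> p" "0 \<le> a" "0 \<le> b" "a + b = 1" "0 \<le> s" "0 \<le> t"
  shows "(a * s + b * t) powr p \<le> a * s powr p + b * t powr p"
proof -
  have le: "c powr p \<le> c" if "0 \<le> c" "c \<le> 1" for c :: real
    using powr_mono'[of 1 p c] that assms(1) by simp
  consider "s = 0" | "t = 0" | "0 < s" "0 < t"
    using assms by linarith
  then show ?thesis
  proof cases
    case 1
    have "b powr p * t powr p \<le> b * t powr p"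
      using assms le by (intro mult_right_mono) auto
    then show ?thesis
      using 1 assms by (simp add: powr_mult)
  next
    case 2
    have "a powr p * s powr p \<le> a * s powr p"
      using assms le by (intro mult_right_mono) auto
    then show ?thesis
      using 2 assms by (simp add: powr_mult)
  next
    case 3
    have "convex_on {0<..} (\<lambda>x::real. x powr p)"
      by (rule powr_convex[OF assms(1)])
    then show ?thesis
      using assms 3 unfolding convex_on_def by auto
  qed
qed

text \<open>Minkowski's inequality. After scaling by upper bounds \<open>A\<close> and \<open>B\<close> of the two norms, the sum is
\<open>A + B\<close> times a convex combination of sequences in the unit ball, and convexity is applied entry
by entry. The bounds are taken slightly larger than the norms so that they are positive.\<close>

lemma lp_add:
  assumes p: "1 \<le> p" and x: "x \<in> lp_space p" and y: "y \<in> lp_space p"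
  shows "x + y \<in> lp_space p" "lp_norm p (x + y) \<le> lp_norm p x + lp_norm p y"
proof -
  have le: "x + y \<in> lp_space p \<and> lp_norm p (x + y) \<le> A + B"
    if A: "lp_norm p x \<le> A" "0 < A" and B: "lp_norm p y \<le> B" "0 < B" for A B
  proof -
    have "(\<Sum>n\<in>F. norm ((x + y) n) powr p) \<le> (A + B) powr p" if F: "finite F" for F
    proof -
      define a b where "a = A / (A + B)" and "b = B / (A + B)"
      have ab: "0 \<le> a" "0 \<le> b" "a + b = 1"
        using A B by (auto simp: a_def b_def add_divide_distrib[symmetric])
      have unit: "(\<Sum>n\<in>F. (norm (z n) / D) powr p) \<le> 1"
        if "z \<in> lp_space p" "lp_norm p z \<le> D" "0 < D" for D and z :: "int \<Rightarrow> 'a"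
      proof -
        have "(\<Sum>n\<in>F. norm (z n) powr p) \<le> D powr p"
          using sum_powr_le_lp_norm[OF p that(1) F] powr_mono2[OF _ lp_norm_nonneg that(2), of p] p
          by linarith
        then have "(\<Sum>n\<in>F. norm (z n) powr p) / D powr p \<le> 1"
          using that by simp
        then show ?thesis
          using that by (simp add: powr_divide sum_divide_distrib)
      qed
      have "(\<Sum>n\<in>F. norm ((x + y) n) powr p)
          \<le> (\<Sum>n\<in>F. (A + B) powr p * (a * (norm (x n) / A) powr p + b * (norm (y n) / B) powr p))"
      proof (rule sum_mono)
        fix n
        have "(A + B) * (a * (norm (x n) / A) + b * (norm (y n) / B)) = norm (x n) + norm (y n)"
          using A B by (simp add: a_def b_def distrib_left)
        then have "norm ((x + y) n) \<le> (A + B) * (a * (norm (x n) / A) + b * (norm (y n) / B))"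
          using norm_triangle_ineq[of "x n" "y n"] by simp
        then have "norm ((x + y) n) powr p
            \<le> ((A + B) * (a * (norm (x n) / A) + b * (norm (y n) / B))) powr p"
          using p by (intro powr_mono2) auto
        also have "\<dots> = (A + B) powr p * (a * (norm (x n) / A) + b * (norm (y n) / B)) powr p"
          using A B ab by (subst powr_mult) auto
        also have "\<dots> \<le> (A + B) powr p *
            (a * (norm (x n) / A) powr p + b * (norm (y n) / B) powr p)"
          using p ab A B by (intro mult_left_mono convex_combination_powr_le) auto
        finally show "norm ((x + y) n) powr p \<le> \<dots>" .
      qed
      also have "\<dots> = (A + B) powr p * (a * (\<Sum>n\<in>F. (norm (x n) / A) powr p)
          + b * (\<Sum>n\<in>F. (norm (y n) / B) powr p))"
        by (simp add: sum_distrib_left sum.distrib distrib_left)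
      also have "\<dots> \<le> (A + B) powr p * (a * 1 + b * 1)"
        using ab unit[OF x A] unit[OF y B] by (intro mult_left_mono add_mono) auto
      finally show ?thesis
        using ab by simp
    qed
    then show ?thesis
      using p A B lp_boundedI[of p "A + B" "x + y"] by auto
  qed
  have eps: "x + y \<in> lp_space p \<and> lp_norm p (x + y) \<le> lp_norm p x + lp_norm p y + e"
    if "0 < e" for e
    using le[of "lp_norm p x + e / 2" "lp_norm p y + e / 2"] that
      lp_norm_nonneg[of p x] lp_norm_nonneg[of p y] by simp
  show "x + y \<in> lp_space p"
    using eps[of 1] by simp
  show "lp_norm p (x + y) \<le> lp_norm p x + lp_norm p y"
  proof (rule field_le_epsilon)
    fix e :: real assume "0 < e"
    from eps[OF this] show "lp_norm p (x + y) \<le> lp_norm p x + lp_norm p y + e" ..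
  qed
qed

lemma lp_diff:
  assumes "1 \<le> p" "x \<in> lp_space p" "y \<in> lp_space p"
  shows "x - y \<in> lp_space p" "lp_norm p (x - y) \<le> lp_norm p x + lp_norm p y"
  using lp_add[OF assms(1,2) lp_uminus(1)[OF assms(1,3)]] lp_uminus[OF assms(1,3)] by simp_all

lemma Metric_space_lp:
  assumes "1 \<le> p"
  shows "Metric_space (lp_space p) (\<lambda>x y :: int \<Rightarrow> 'a::real_normed_vector. lp_norm p (x - y))"
proof
  fix x y z :: "int \<Rightarrow> 'a"
  show "0 \<le> lp_norm p (x - y)"
    by (rule lp_norm_nonneg)
  show "lp_norm p (x - y) = lp_norm p (y - x)"
    by (simp add: lp_norm_def norm_minus_commute)
  assume x: "x \<in> lp_space p" and y: "y \<in> lp_space p"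
  show "lp_norm p (x - y) = 0 \<longleftrightarrow> x = y"
    using lp_norm_eq_0_iff[OF assms lp_diff(1)[OF assms x y]] by simp
  assume z: "z \<in> lp_space p"
  show "lp_norm p (x - z) \<le> lp_norm p (x - y) + lp_norm p (y - z)"
    using lp_add(2)[OF assms lp_diff(1)[OF assms x y] lp_diff(1)[OF assms y z]] by simp
qed

text \<open>Series are formed entrywise: absolute convergence in each entry comes from completeness of the
entry space, and the norm bound passes from the partial sums to the limit.\<close>

lemma lp_suminf:
  fixes y :: "nat \<Rightarrow> int \<Rightarrow> 'a::banach"
  assumes p: "1 \<le> p" and y: "\<And>k. y k \<in> lp_space p"
    and \<beta>: "\<And>k. lp_norm p (y k) \<le> \<beta> k" "summable \<beta>"
  shows "summable (\<lambda>k. y k n)"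
    and "(\<lambda>n. \<Sum>k. y k n) \<in> lp_space p"
    and "lp_norm p (\<lambda>n. \<Sum>k. y k n) \<le> suminf \<beta>"
proof -
  have \<beta>0: "0 \<le> \<beta> k" for k
    using \<beta>(1)[of k] lp_norm_nonneg[of p "y k"] by linarith
  have "norm (y k n) \<le> \<beta> k" for k n
    using norm_le_lp_norm[OF p y, of k n] \<beta>(1)[of k] by linarith
  then show summable: "summable (\<lambda>k. y k n)" for n
    by (intro summable_comparison_test'[OF \<beta>(2), of 0]) auto
  have partial: "(\<lambda>n. \<Sum>k<m. y k n) \<in> lp_space p \<and>
      lp_norm p (\<lambda>n. \<Sum>k<m. y k n) \<le> (\<Sum>k<m. \<beta> k)" for m
  proof (induction m)
    case 0
    show ?case
      using zero_in_lp_space[of p, where 'a = 'a] lp_norm_zero[of p, where 'a = 'a]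
      by (simp add: zero_fun_def)
  next
    case (Suc m)
    have eq: "(\<lambda>n. \<Sum>k<Suc m. y k n) = (\<lambda>n. \<Sum>k<m. y k n) + y m"
      by (simp add: fun_eq_iff)
    show ?case
      unfolding eq sum.lessThan_Suc[of \<beta>]
      using lp_add[OF p conjunct1[OF Suc.IH] y] Suc.IH \<beta>(1)[of m] by (meson add_mono order_trans)
  qed
  have "(\<Sum>n\<in>F. norm (\<Sum>k. y k n) powr p) \<le> suminf \<beta> powr p" if F: "finite F" for F
  proof (rule tendsto_upperbound)
    show "(\<lambda>m. \<Sum>n\<in>F. norm (\<Sum>k<m. y k n) powr p)
        \<longlonglongrightarrow> (\<Sum>n\<in>F. norm (\<Sum>k. y k n) powr p)"
      using p by (intro tendsto_sum tendsto_powr2 tendsto_norm summable_LIMSEQ summable) auto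
    have "(\<Sum>n\<in>F. norm (\<Sum>k<m. y k n) powr p) \<le> suminf \<beta> powr p" for m
    proof -
      have "(\<Sum>n\<in>F. norm (\<Sum>k<m. y k n) powr p) \<le> lp_norm p (\<lambda>n. \<Sum>k<m. y k n) powr p"
        using partial by (intro sum_powr_le_lp_norm p F) auto
      also have "\<dots> \<le> suminf \<beta> powr p"
        using p partial[of m] sum_le_suminf[OF \<beta>(2), of "{..<m}"] \<beta>0
        by (intro powr_mono2) (auto simp: lp_norm_nonneg)
      finally show ?thesis .
    qed
    then show "\<forall>\<^sub>F m in sequentially.
        (\<Sum>n\<in>F. norm (\<Sum>k<m. y k n) powr p) \<le> suminf \<beta> powr p"
      by simp
  qed auto
  note bound = lp_boundedI[of p "suminf \<beta>" "\<lambda>n. \<Sum>k. y k n",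
      OF p suminf_nonneg[OF \<beta>(2) \<beta>0] this]
  show "(\<lambda>n. \<Sum>k. y k n) \<in> lp_space p"
    by (rule bound(1))
  show "lp_norm p (\<lambda>n. \<Sum>k. y k n) \<le> suminf \<beta>"
    by (rule bound(2))
qed


section \<open>Spectral radii and geometric decay\<close>

text \<open>Fekete's lemma. If \<open>root m (a m) < \<rho>\<close> for one \<open>m\<close>, splitting off blocks of length \<open>m\<close> shows
that \<open>a n\<close> is at most a constant times \<open>\<rho>\<^sup>n\<close>, so no subsequence of the roots stays bounded away from the
infimum \<open>L\<close>. The geometric bounds themselves are recorded because they are what is used later.\<close>

lemma submultiplicative_root_limit:
  fixes a :: "nat \<Rightarrow> real"
  assumes nonneg: "\<And>n. 0 \<le> a n" and submult: "\<And>m n. a (m + n) \<le> a m * a n"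
  obtains L where "(\<lambda>n. root n (a n)) \<longlonglongrightarrow> L"
    and "\<And>\<rho>. L < \<rho> \<Longrightarrow> \<exists>D>0. \<forall>n. a n \<le> D * \<rho> ^ n"
proof -
  define L where "L = (INF n\<in>{1..}. root n (a n))"
  have bdd: "bdd_below ((\<lambda>n. root n (a n)) ` {1..})"
    by (rule bdd_belowI[of _ 0]) (auto intro: nonneg)
  have L_le: "L \<le> root n (a n)" if "1 \<le> n" for n
    unfolding L_def using bdd that by (intro cINF_lower) auto
  have "0 \<le> L"
    unfolding L_def using nonneg by (intro cINF_greatest) auto
  have geometric: "\<exists>D>0. \<forall>n. a n \<le> D * \<rho> ^ n" if "L < \<rho>" for \<rho>
  proof -
    obtain m where m: "1 \<le> m" "root m (a m) < \<rho>"
      using \<open>L < \<rho>\<close> cINF_less_iff[OF _ bdd, of \<rho>] unfolding L_def by fastforce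
    have "0 < \<rho>"
      using that \<open>0 \<le> L\<close> by linarith
    have am: "a m \<le> \<rho> ^ m"
    proof -
      have "a m = root m (a m) ^ m"
        using m nonneg by simp
      also have "\<dots> \<le> \<rho> ^ m"
        using m nonneg by (intro power_mono) auto
      finally show ?thesis .
    qed
    \<comment> \<open>The constant absorbs the remainder modulo \<open>m\<close>; the summand \<open>1\<close> makes it positive.\<close>
    define D where "D = 1 + (\<Sum>r<m. a r / \<rho> ^ r)"
    have "0 < D"
      unfolding D_def using nonneg \<open>0 < \<rho>\<close> by (intro add_pos_nonneg sum_nonneg) auto
    have "a n \<le> D * \<rho> ^ n" for n
    proof (induction n rule: less_induct)
      case (less n)
      show ?case
      proof (cases "n < m")
        case True
        have "a n / \<rho> ^ n \<le> (\<Sum>r<m. a r / \<rho> ^ r)"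
          using True nonneg \<open>0 < \<rho>\<close> by (intro member_le_sum) auto
        then have "a n / \<rho> ^ n \<le> D"
          by (simp add: D_def)
        then show ?thesis
          using \<open>0 < \<rho>\<close> by (simp add: field_simps)
      next
        case False
        then have n: "n = m + (n - m)"
          by simp
        have "a n \<le> a m * a (n - m)"
          using submult[of m "n - m"] n by simp
        also have "\<dots> \<le> \<rho> ^ m * (D * \<rho> ^ (n - m))"
          using am less.IH[of "n - m"] m False nonneg \<open>0 < \<rho>\<close> by (intro mult_mono) auto
        also have "\<dots> = D * \<rho> ^ n"
          using power_add[of \<rho> m "n - m"] n by (simp add: mult_ac)
        finally show ?thesis .
      qed
    qed
    then show ?thesis
      using \<open>0 < D\<close> by blast
  qed
  have "(\<lambda>n. root n (a n)) \<longlonglongrightarrow> L"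
  proof (rule order_tendstoI)
    fix y assume "y < L"
    then show "\<forall>\<^sub>F n in sequentially. y < root n (a n)"
      using L_le by (intro eventually_sequentiallyI[of 1]) (meson less_le_trans)
  next
    fix y assume y: "L < y"
    define \<rho> where "\<rho> = (L + y) / 2"
    have \<rho>: "L < \<rho>" "\<rho> < y" "0 < \<rho>"
      using y \<open>0 \<le> L\<close> by (auto simp: \<rho>_def)
    then obtain D where D: "D > 0" "\<And>n. a n \<le> D * \<rho> ^ n"
      using geometric by blast
    have "(\<lambda>n. root n D * \<rho>) \<longlonglongrightarrow> 1 * \<rho>"
      by (intro tendsto_mult LIMSEQ_root_const D tendsto_const)
    then have "\<forall>\<^sub>F n in sequentially. root n D * \<rho> < y"
      using \<rho> by (intro order_tendstoD(2)) auto
    then show "\<forall>\<^sub>F n in sequentially. root n (a n) < y"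
      using eventually_gt_at_top[of 0]
    proof eventually_elim
      case (elim n)
      have "root n (a n) \<le> root n (D * \<rho> ^ n)"
        using elim D(2) by simp
      also have "\<dots> = root n D * \<rho>"
        using elim \<rho> by (simp add: real_root_mult real_root_power_cancel)
      finally show ?case
        using elim by simp
    qed
  qed
  then show ?thesis
    using geometric that by blast
qed

text \<open>The restriction of a bounded operator to an invariant subspace. Real scaling turns the supremum
over the unit ball into the usual operator norm inequality for all vectors.\<close>

locale restricted_operator =
  fixes nrm :: "'v \<Rightarrow> real" and smul :: "real \<Rightarrow> 'v \<Rightarrow> 'v" and M :: "'v set"
    and A :: "'v \<Rightarrow> 'v" and D :: real
  assumes nonempty: "M \<noteq> {}"
    and smul_closed: "\<And>r y. y \<in> M \<Longrightarrow> smul r y \<in> M"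
    and nrm_smul: "\<And>r y. y \<in> M \<Longrightarrow> nrm (smul r y) = \<bar>r\<bar> * nrm y"
    and nrm_nonneg: "\<And>y. 0 \<le> nrm y"
    and A_closed: "\<And>y. y \<in> M \<Longrightarrow> A y \<in> M"
    and A_smul: "\<And>r y. y \<in> M \<Longrightarrow> A (smul r y) = smul r (A y)"
    and A_bounded: "\<And>y. y \<in> M \<Longrightarrow> nrm (A y) \<le> D * nrm y"
    and D_nonneg: "0 \<le> D"
begin

lemma funpow_closed: "y \<in> M \<Longrightarrow> (A ^^ n) y \<in> M"
  by (induction n) (auto intro: A_closed)

lemma funpow_smul: "y \<in> M \<Longrightarrow> (A ^^ n) (smul r y) = smul r ((A ^^ n) y)"
  by (induction n) (auto simp: A_smul funpow_closed)

lemma funpow_bounded: "y \<in> M \<Longrightarrow> nrm ((A ^^ n) y) \<le> D ^ n * nrm y"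
proof (induction n)
  case (Suc n)
  have "nrm ((A ^^ Suc n) y) \<le> D * nrm ((A ^^ n) y)"
    using A_bounded[OF funpow_closed[OF Suc.prems]] by simp
  also have "\<dots> \<le> D * (D ^ n * nrm y)"
    using Suc D_nonneg by (intro mult_left_mono) auto
  finally show ?case
    by (simp add: mult_ac)
qed auto

lemma restr_onorm_least:
  assumes "0 \<le> c" "\<And>y. y \<in> M \<Longrightarrow> nrm ((A ^^ n) y) \<le> c * nrm y"
  shows "restr_onorm nrm M (A ^^ n) \<le> c"
  unfolding restr_onorm_def
proof (rule cSup_least)
  obtain y where "y \<in> M"
    using nonempty by blast
  then have "smul 0 y \<in> M \<and> nrm (smul 0 y) \<le> 1"
    using smul_closed nrm_smul by simp
  then show "{nrm ((A ^^ n) y) |y. y \<in> M \<and> nrm y \<le> 1} \<noteq> {}"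
    by blast
next
  fix x assume "x \<in> {nrm ((A ^^ n) y) |y. y \<in> M \<and> nrm y \<le> 1}"
  then obtain y where "y \<in> M" "nrm y \<le> 1" "x = nrm ((A ^^ n) y)"
    by blast
  then show "x \<le> c"
    using assms(2)[of y] mult_left_mono[of "nrm y" 1 c] assms(1) by simp
qed

lemma restr_onorm_upper:
  assumes "y \<in> M" "nrm y \<le> 1"
  shows "nrm ((A ^^ n) y) \<le> restr_onorm nrm M (A ^^ n)"
  unfolding restr_onorm_def
proof (rule cSup_upper)
  show "bdd_above {nrm ((A ^^ n) y) |y. y \<in> M \<and> nrm y \<le> 1}"
  proof (rule bdd_aboveI)
    fix x assume "x \<in> {nrm ((A ^^ n) y) |y. y \<in> M \<and> nrm y \<le> 1}"
    then obtain y where "y \<in> M" "nrm y \<le> 1" "x = nrm ((A ^^ n) y)"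
      by blast
    then show "x \<le> D ^ n"
      using funpow_bounded[of y n] mult_left_mono[of "nrm y" 1 "D ^ n"] D_nonneg by simp
  qed
qed (use assms in blast)

lemma restr_onorm_nonneg: "0 \<le> restr_onorm nrm M (A ^^ n)"
proof -
  obtain y where "y \<in> M"
    using nonempty by blast
  then have "smul 0 y \<in> M" "nrm (smul 0 y) \<le> 1"
    using smul_closed nrm_smul by simp_all
  then show ?thesis
    using restr_onorm_upper nrm_nonneg order_trans by blast
qed

text \<open>If \<open>nrm y = 0\<close>, the vector cannot be scaled to norm one; then boundedness of \<open>A\<close> makes the left
side vanish.\<close>

lemma le_restr_onorm:
  assumes y: "y \<in> M"
  shows "nrm ((A ^^ n) y) \<le> restr_onorm nrm M (A ^^ n) * nrm y"
proof (cases "nrm y = 0")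
  case True
  then show ?thesis
    using funpow_bounded[OF y, of n] by simp
next
  case False
  define r where "r = inverse (nrm y)"
  have "0 < r"
    using False nrm_nonneg[of y] by (simp add: r_def)
  have "nrm ((A ^^ n) (smul r y)) \<le> restr_onorm nrm M (A ^^ n)"
    using y False \<open>0 < r\<close>
    by (intro restr_onorm_upper smul_closed) (simp_all add: nrm_smul r_def nrm_nonneg)
  then have "r * nrm ((A ^^ n) y) \<le> restr_onorm nrm M (A ^^ n)"
    using y \<open>0 < r\<close> by (simp add: funpow_smul nrm_smul funpow_closed)
  then show ?thesis
    using \<open>0 < r\<close> False nrm_nonneg[of y] by (simp add: r_def field_simps)
qed

lemma restr_onorm_submult:
  "restr_onorm nrm M (A ^^ (m + n)) \<le> restr_onorm nrm M (A ^^ m) * restr_onorm nrm M (A ^^ n)"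
proof (rule restr_onorm_least)
  fix y assume y: "y \<in> M"
  have "nrm ((A ^^ (m + n)) y) \<le> restr_onorm nrm M (A ^^ m) * nrm ((A ^^ n) y)"
    using le_restr_onorm[OF funpow_closed[OF y]] by (simp add: funpow_add)
  also have "\<dots> \<le> restr_onorm nrm M (A ^^ m) * (restr_onorm nrm M (A ^^ n) * nrm y)"
    by (intro mult_left_mono le_restr_onorm y restr_onorm_nonneg)
  finally show "nrm ((A ^^ (m + n)) y)
      \<le> restr_onorm nrm M (A ^^ m) * restr_onorm nrm M (A ^^ n) * nrm y"
    by (simp add: mult_ac)
qed (simp add: restr_onorm_nonneg)

text \<open>The constant \<open>C\<close> disappears in the limit of the \<open>n\<close>-th roots; conversely any \<open>\<theta>\<close> strictly
between the spectral radius and \<open>1\<close> is a decay rate.\<close>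

theorem spectral_radius_less_1_iff:
  "(\<exists>r<1. has_spectral_radius_on nrm M A r) \<longleftrightarrow>
   (\<exists>C \<theta>. 0 < C \<and> 0 < \<theta> \<and> \<theta> < 1 \<and> (\<forall>n. \<forall>y\<in>M. nrm ((A ^^ n) y) \<le> C * \<theta> ^ n * nrm y))"
proof -
  define q where "q n = restr_onorm nrm M (A ^^ n)" for n
  obtain L where L: "(\<lambda>n. root n (q n)) \<longlonglongrightarrow> L"
    and geometric: "\<And>\<rho>. L < \<rho> \<Longrightarrow> \<exists>C>0. \<forall>n. q n \<le> C * \<rho> ^ n"
    using submultiplicative_root_limit[of q] restr_onorm_nonneg restr_onorm_submult
    unfolding q_def by blast
  have sr: "has_spectral_radius_on nrm M A r \<longleftrightarrow> r = L" for r
    using L LIMSEQ_unique unfolding has_spectral_radius_on_def q_def by blast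
  have "L < 1 \<longleftrightarrow>
    (\<exists>C \<theta>. 0 < C \<and> 0 < \<theta> \<and> \<theta> < 1 \<and> (\<forall>n. \<forall>y\<in>M. nrm ((A ^^ n) y) \<le> C * \<theta> ^ n * nrm y))"
  proof
    assume "L < 1"
    then obtain \<theta> where \<theta>: "max L 0 < \<theta>" "\<theta> < 1"
      using dense[of "max L 0" 1] by auto
    then obtain C where C: "C > 0" "\<And>n. q n \<le> C * \<theta> ^ n"
      using geometric[of \<theta>] by auto
    have "nrm ((A ^^ n) y) \<le> C * \<theta> ^ n * nrm y" if "y \<in> M" for n y
      using le_restr_onorm[OF that, of n] mult_right_mono[OF C(2)[of n] nrm_nonneg[of y]]
      by (simp add: q_def)
    then show "\<exists>C \<theta>. 0 < C \<and> 0 < \<theta> \<and> \<theta> < 1 \<and>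
        (\<forall>n. \<forall>y\<in>M. nrm ((A ^^ n) y) \<le> C * \<theta> ^ n * nrm y)"
      using C(1) \<theta> by (intro exI[of _ C] exI[of _ \<theta>]) auto
  next
    assume "\<exists>C \<theta>. 0 < C \<and> 0 < \<theta> \<and> \<theta> < 1 \<and>
        (\<forall>n. \<forall>y\<in>M. nrm ((A ^^ n) y) \<le> C * \<theta> ^ n * nrm y)"
    then obtain C \<theta> where C: "0 < C" and \<theta>: "0 < \<theta>" "\<theta> < 1"
      and decay: "\<And>n y. y \<in> M \<Longrightarrow> nrm ((A ^^ n) y) \<le> C * \<theta> ^ n * nrm y"
      by blast
    have "q n \<le> C * \<theta> ^ n" for n
      unfolding q_def using C \<theta> decay by (intro restr_onorm_least) auto
    then have le: "root n (q n) \<le> root n C * \<theta>" if "0 < n" for n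
    proof -
      have "root n (q n) \<le> root n (C * \<theta> ^ n)"
        using that \<open>\<And>n. q n \<le> C * \<theta> ^ n\<close> by simp
      then show ?thesis
        using that \<theta> by (simp add: real_root_mult real_root_power_cancel)
    qed
    have "(\<lambda>n. root n C * \<theta>) \<longlonglongrightarrow> 1 * \<theta>"
      by (intro tendsto_mult LIMSEQ_root_const C tendsto_const)
    then have "L \<le> 1 * \<theta>"
      using L le by (intro LIMSEQ_le[of _ L _ "1 * \<theta>"]) (auto intro!: exI[of _ 1])
    then show "L < 1"
      using \<theta> by simp
  qed
  then show ?thesis
    unfolding sr by simp
qed

end


section \<open>Decompositions into closed subspaces\<close>

lemma vector_space_seq_scale:
  assumes "vector_space scl"
  shows "vector_space (seq_scale scl)"
proof -
  interpret vector_space scl by (rule assms)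
  show ?thesis
    by unfold_locales (auto simp: seq_scale_def scale_right_distrib scale_left_distrib)
qed

locale lp_over = normed_space_over scl
  for scl :: "'k::real_or_complex \<Rightarrow> 'a::banach \<Rightarrow> 'a" +
  fixes p :: real
  assumes p_ge_1: "1 \<le> p"
begin

sublocale seq: vector_space "seq_scale scl"
  by (rule vector_space_seq_scale) unfold_locales

sublocale lp: Metric_space "lp_space p :: (int \<Rightarrow> 'a) set" "\<lambda>x y. lp_norm p (x - y)"
  by (rule Metric_space_lp[OF p_ge_1])

lemma seq_scale_of_real: "seq_scale scl (of_real r) y = (\<lambda>n. r *\<^sub>R y n)"
  by (simp add: seq_scale_def scale_of_real)

lemma subspace_scaleR:
  assumes "seq.subspace M" "y \<in> M"
  shows "(\<lambda>n. r *\<^sub>R y n) \<in> M"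
  using seq.subspace_scale[OF assms, of "of_real r"] by (simp add: seq_scale_of_real)

lemma norm_diff_le_lp_norm:
  assumes "x \<in> lp_space p" "y \<in> lp_space p"
  shows "norm (x n - y n) \<le> lp_norm p (x - y :: int \<Rightarrow> 'a)"
  using norm_le_lp_norm[OF p_ge_1 lp_diff(1)[OF p_ge_1 assms], of n] by simp

text \<open>The entrywise limit of a Cauchy sequence is its limit in norm, because the Cauchy estimate on a
finite set of positions survives letting one of the two indices tend to infinity.\<close>

lemma lp_complete: "lp.mcomplete"
  unfolding lp.mcomplete_def
proof (intro allI impI)
  fix \<sigma> :: "nat \<Rightarrow> int \<Rightarrow> 'a"
  assume "lp.MCauchy \<sigma>"
  note MCauchy = this[unfolded lp.MCauchy_def]
  have range: "range \<sigma> \<subseteq> lp_space p"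
    using MCauchy by (rule conjunct1)
  have cauchy: "\<forall>e>0. \<exists>N. \<forall>m n. N \<le> m \<longrightarrow> N \<le> n \<longrightarrow> lp_norm p (\<sigma> m - \<sigma> n) < e"
    using MCauchy by (rule conjunct2)
  have \<sigma>: "\<sigma> n \<in> lp_space p" for n
    using range by blast
  have "Cauchy (\<lambda>n. \<sigma> n j)" for j
  proof (rule metric_CauchyI)
    fix e :: real assume "0 < e"
    then obtain N where N: "\<And>m n. N \<le> m \<Longrightarrow> N \<le> n \<Longrightarrow> lp_norm p (\<sigma> m - \<sigma> n) < e"
      using cauchy by blast
    have "dist (\<sigma> m j) (\<sigma> n j) < e" if "N \<le> m" "N \<le> n" for m n
      using norm_diff_le_lp_norm[OF \<sigma> \<sigma>, of m j n] N[OF that] by (simp add: dist_norm)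
    then show "\<exists>N. \<forall>m\<ge>N. \<forall>n\<ge>N. dist (\<sigma> m j) (\<sigma> n j) < e"
      by blast
  qed
  then have "\<exists>l. (\<lambda>n. \<sigma> n j) \<longlonglongrightarrow> l" for j
    using Cauchy_convergent convergent_def by blast
  then obtain l where l: "\<And>j. (\<lambda>n. \<sigma> n j) \<longlonglongrightarrow> l j"
    by metis
  have close: "\<sigma> m - l \<in> lp_space p \<and> lp_norm p (\<sigma> m - l) \<le> e"
    if "0 < e" and N: "\<And>m n. N \<le> m \<Longrightarrow> N \<le> n \<Longrightarrow> lp_norm p (\<sigma> m - \<sigma> n) < e" and "N \<le> m" for e N m
  proof -
    have "(\<Sum>j\<in>F. norm ((\<sigma> m - l) j) powr p) \<le> e powr p" if F: "finite F" for F
    proof (rule tendsto_upperbound)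
      show "(\<lambda>n. \<Sum>j\<in>F. norm ((\<sigma> m - \<sigma> n) j) powr p)
          \<longlonglongrightarrow> (\<Sum>j\<in>F. norm ((\<sigma> m - l) j) powr p)"
        using p_ge_1 l unfolding fun_diff_def
        by (intro tendsto_sum tendsto_powr2 tendsto_norm tendsto_diff) auto
      have "(\<Sum>j\<in>F. norm ((\<sigma> m - \<sigma> n) j) powr p) \<le> e powr p" if "N \<le> n" for n
      proof -
        have "(\<Sum>j\<in>F. norm ((\<sigma> m - \<sigma> n) j) powr p) \<le> lp_norm p (\<sigma> m - \<sigma> n) powr p"
          by (intro sum_powr_le_lp_norm lp_diff \<sigma> p_ge_1 F)
        also have "\<dots> \<le> e powr p"
          using N[OF \<open>N \<le> m\<close> that] p_ge_1 by (intro powr_mono2) (auto simp: lp_norm_nonneg)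
        finally show ?thesis .
      qed
      then show "\<forall>\<^sub>F n in sequentially. (\<Sum>j\<in>F. norm ((\<sigma> m - \<sigma> n) j) powr p) \<le> e powr p"
        by (intro eventually_sequentiallyI[of N])
    qed auto
    then show ?thesis
      using lp_boundedI[OF p_ge_1, of e "\<sigma> m - l"] \<open>0 < e\<close> by fastforce
  qed
  have "l \<in> lp_space p"
  proof -
    obtain N where "\<And>m n. N \<le> m \<Longrightarrow> N \<le> n \<Longrightarrow> lp_norm p (\<sigma> m - \<sigma> n) < 1"
      using cauchy[rule_format, of 1] by auto
    from close[OF _ this, of N] have "\<sigma> N - l \<in> lp_space p"
      by simp
    from lp_diff(1)[OF p_ge_1 \<sigma>[of N] this] show ?thesis
      by simp
  qed
  moreover have "(\<lambda>n. lp_norm p (\<sigma> n - l)) \<longlonglongrightarrow> 0"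
  proof (rule LIMSEQ_I)
    fix r :: real assume "0 < r"
    then obtain N where N: "\<And>m n. N \<le> m \<Longrightarrow> N \<le> n \<Longrightarrow> lp_norm p (\<sigma> m - \<sigma> n) < r / 2"
      using cauchy[rule_format, of "r / 2"] by auto
    have "norm (lp_norm p (\<sigma> n - l) - 0) < r" if "N \<le> n" for n
      using close[OF _ N that] \<open>0 < r\<close> lp_norm_nonneg[of p "\<sigma> n - l"] by simp
    then show "\<exists>N. \<forall>n\<ge>N. norm (lp_norm p (\<sigma> n - l) - 0) < r"
      by blast
  qed
  ultimately show "\<exists>x. limitin lp.mtopology \<sigma> x sequentially"
    using \<sigma> by (intro exI[of _ l]) (simp add: lp.limitin_metric_dist_null)
qed

lemma closed_subspace_suminf:
  fixes y :: "nat \<Rightarrow> int \<Rightarrow> 'a"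
  assumes M: "closed_subspace (seq_scale scl) (lp_space p) (lp_norm p) M"
    and y: "\<And>k. y k \<in> M" and \<beta>: "\<And>k. lp_norm p (y k) \<le> \<beta> k" "summable \<beta>"
  shows "(\<lambda>n. \<Sum>k. y k n) \<in> M"
proof -
  have sub: "seq.subspace M" and closed: "closedin lp.mtopology M"
    using M by (auto simp: closed_subspace_def)
  have "M \<subseteq> lp_space p"
    using closedin_subset[OF closed] by simp
  then have y_lp: "y k \<in> lp_space p" for k
    using y by blast
  note sm = lp_suminf[OF p_ge_1 y_lp \<beta>]
  define s where "s = (\<lambda>n. \<Sum>k. y k n)"
  define \<sigma> where "\<sigma> m = (\<lambda>n. \<Sum>k<m. y k n)" for m
  have \<sigma>_M: "\<sigma> m \<in> M" for m
  proof (induction m)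
    case 0
    show ?case
      using seq.subspace_0[OF sub] by (simp add: \<sigma>_def zero_fun_def)
  next
    case (Suc m)
    have "\<sigma> (Suc m) = \<sigma> m + y m"
      by (simp add: \<sigma>_def fun_eq_iff)
    then show ?case
      using seq.subspace_add[OF sub Suc.IH y] by metis
  qed
  have "(\<lambda>m. suminf \<beta> - (\<Sum>k<m. \<beta> k)) \<longlonglongrightarrow> suminf \<beta> - suminf \<beta>"
    by (intro tendsto_diff tendsto_const summable_LIMSEQ \<beta>)
  then have tail: "(\<lambda>m. suminf \<beta> - (\<Sum>k<m. \<beta> k)) \<longlonglongrightarrow> 0"
    by simp
  have le: "lp_norm p (\<sigma> m - s) \<le> suminf \<beta> - (\<Sum>k<m. \<beta> k)" for m
  proof -
    have sum_\<beta>: "summable (\<lambda>k. \<beta> (k + m))"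
      using \<beta>(2) by simp
    have "s - \<sigma> m = (\<lambda>n. \<Sum>k. y (k + m) n)"
      using suminf_minus_initial_segment[OF sm(1)] by (simp add: s_def \<sigma>_def fun_eq_iff)
    then have "lp_norm p (s - \<sigma> m) \<le> (\<Sum>k. \<beta> (k + m))"
      using lp_suminf(3)[OF p_ge_1, of "\<lambda>k. y (k + m)" "\<lambda>k. \<beta> (k + m)"] y_lp \<beta>(1) sum_\<beta> by simp
    then show ?thesis
      using suminf_minus_initial_segment[OF \<beta>(2), of m] lp.commute[of s "\<sigma> m"] by simp
  qed
  have "(\<lambda>m. lp_norm p (\<sigma> m - s)) \<longlonglongrightarrow> 0"
    by (rule tendsto_sandwich[OF _ _ tendsto_const tail]) (auto simp: lp_norm_nonneg le)
  then have "limitin lp.mtopology \<sigma> s sequentially"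
    using sm(2) \<sigma>_M \<open>M \<subseteq> lp_space p\<close>
    by (simp add: lp.limitin_metric_dist_null s_def subset_iff)
  then have "s \<in> M"
    using closed \<sigma>_M unfolding lp.metric_closedin_iff_sequentially_closed by blast
  then show ?thesis
    by (simp add: s_def)
qed

text \<open>The Baire category step of the open mapping theorem. The sets \<open>W k\<close> of sums of two vectors of
norm at most \<open>k\<close> cover the space, so the closure of some \<open>W k\<close> contains a ball. Subtracting
its centre moves the ball to the origin at the price of doubling \<open>k\<close>, and scaling yields an
approximation of every \<open>y\<close> that leaves half of its norm as error.\<close>

lemma approximate_bounded_decomposition:
  assumes M: "seq.subspace M" "M \<subseteq> lp_space p" and N: "seq.subspace N" "N \<subseteq> lp_space p"
    and sum: "{u + v |u v. u \<in> M \<and> v \<in> N} = lp_space p"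
  obtains \<kappa> where "0 < \<kappa>"
    and "\<And>y. y \<in> lp_space p \<Longrightarrow> \<exists>u\<in>M. \<exists>v\<in>N. lp_norm p u \<le> \<kappa> * lp_norm p y \<and>
      lp_norm p v \<le> \<kappa> * lp_norm p y \<and> lp_norm p (y - (u + v)) \<le> lp_norm p y / 2"
proof -
  define W where "W k = {u + v |u v. u \<in> M \<and> v \<in> N \<and> lp_norm p u \<le> real k \<and> lp_norm p v \<le> real k}"
    for k
  have W_lp: "W k \<subseteq> lp_space p" for k
    using sum by (auto simp: W_def)
  have cover: "lp_space p = (\<Union>k. lp.mtopology closure_of W k)"
  proof
    show "lp_space p \<subseteq> (\<Union>k. lp.mtopology closure_of W k)"
    proof
      fix y :: "int \<Rightarrow> 'a"
      assume "y \<in> lp_space p"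
      then obtain u v where uv: "u \<in> M" "v \<in> N" "y = u + v"
        using sum by blast
      obtain k where "max (lp_norm p u) (lp_norm p v) \<le> real k"
        using real_arch_simple by blast
      then have "y \<in> W k"
        using uv by (auto simp: W_def)
      then show "y \<in> (\<Union>k. lp.mtopology closure_of W k)"
        using closure_of_subset[of "W k" lp.mtopology] W_lp by auto
    qed
    show "(\<Union>k. lp.mtopology closure_of W k) \<subseteq> lp_space p"
      using closure_of_subset_topspace[of lp.mtopology] by auto
  qed
  have "\<exists>k. lp.mtopology interior_of (lp.mtopology closure_of W k) \<noteq> {}"
  proof (rule ccontr)
    assume "\<not> ?thesis"
    then have "lp.mtopology interior_of \<Union>(range (\<lambda>k. lp.mtopology closure_of W k)) = {}"
      by (intro lp.metric_Baire_category_alt lp_complete) auto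
    then have "lp.mtopology interior_of lp_space p = {}"
      using cover by simp
    then show False
      using interior_of_topspace[of lp.mtopology] zero_in_lp_space[of p, where 'a = 'a] by auto
  qed
  then obtain k y0 r where y0: "y0 \<in> lp_space p" "0 < r"
    and ball: "lp.mball y0 r \<subseteq> lp.mtopology closure_of W k"
    unfolding lp.metric_interior_of by blast
  have near: "\<exists>w\<in>W k. lp_norm p (y - w) < e"
    if "y \<in> lp_space p" "lp_norm p (y - y0) < r" "0 < e" for y e
  proof -
    have "y \<in> lp.mball y0 r"
      using that y0 lp.commute[of y y0] by simp
    then show ?thesis
      using ball that(3) unfolding lp.metric_closure_of by fastforce
  qed
  have approx: "\<exists>u\<in>M. \<exists>v\<in>N. lp_norm p u \<le> 2 * k \<and> lp_norm p v \<le> 2 * k \<and>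
      lp_norm p (y - (u + v)) \<le> 2 * e"
    if y: "y \<in> lp_space p" "lp_norm p y < r" "0 < e" for y e
  proof -
    obtain w1 where w1: "w1 \<in> W k" "lp_norm p (y0 + y - w1) < e"
      using near[of "y0 + y" e] y y0 lp_add(1)[OF p_ge_1] by auto
    obtain w2 where w2: "w2 \<in> W k" "lp_norm p (y0 - w2) < e"
      using near[of y0 e] y y0 by auto
    obtain u1 v1 where 1: "u1 \<in> M" "v1 \<in> N" "lp_norm p u1 \<le> k" "lp_norm p v1 \<le> k" "w1 = u1 + v1"
      using w1 by (auto simp: W_def)
    obtain u2 v2 where 2: "u2 \<in> M" "v2 \<in> N" "lp_norm p u2 \<le> k" "lp_norm p v2 \<le> k" "w2 = u2 + v2"
      using w2 by (auto simp: W_def)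
    have "lp_norm p (u1 - u2) \<le> 2 * k" "lp_norm p (v1 - v2) \<le> 2 * k"
      using lp_diff(2)[OF p_ge_1, of u1 u2] lp_diff(2)[OF p_ge_1, of v1 v2] 1 2 M(2) N(2)
      by (auto simp: subset_iff)
    moreover have "lp_norm p (y - ((u1 - u2) + (v1 - v2))) \<le> 2 * e"
    proof -
      have "y - ((u1 - u2) + (v1 - v2)) = (y0 + y - w1) - (y0 - w2)"
        by (simp add: 1(5) 2(5) algebra_simps)
      moreover have "lp_norm p ((y0 + y - w1) - (y0 - w2))
          \<le> lp_norm p (y0 + y - w1) + lp_norm p (y0 - w2)"
        using w1 w2 y y0 W_lp by (intro lp_diff(2) lp_diff(1) lp_add(1) p_ge_1) auto
      ultimately have "lp_norm p (y - ((u1 - u2) + (v1 - v2)))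
          \<le> lp_norm p (y0 + y - w1) + lp_norm p (y0 - w2)"
        by metis
      also have "\<dots> \<le> 2 * e"
        using w1(2) w2(2) by linarith
      finally show ?thesis .
    qed
    moreover have "u1 - u2 \<in> M" "v1 - v2 \<in> N"
      using 1 2 seq.subspace_diff M(1) N(1) by blast+
    ultimately show ?thesis
      by blast
  qed
  \<comment> \<open>Vectors of norm \<open>r / 2\<close> need parts of norm \<open>2 k\<close>, a ratio of \<open>4 k / r\<close>; adding \<open>1\<close> keeps it
    positive for \<open>k = 0\<close>.\<close>
  define \<kappa> where "\<kappa> = (4 * real k + 1) / r"
  have "0 < \<kappa>"
    using y0 by (simp add: \<kappa>_def)
  moreover have "\<exists>u\<in>M. \<exists>v\<in>N. lp_norm p u \<le> \<kappa> * lp_norm p y \<and>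
      lp_norm p v \<le> \<kappa> * lp_norm p y \<and> lp_norm p (y - (u + v)) \<le> lp_norm p y / 2"
    if y: "y \<in> lp_space p" for y
  proof (cases "y = 0")
    case True
    then show ?thesis
      using seq.subspace_0 M(1) N(1) by (intro bexI[of _ 0]) auto
  next
    case False
    then have pos: "0 < lp_norm p y"
      using lp_norm_eq_0_iff[OF p_ge_1 y] lp_norm_nonneg[of p y] by simp
    define s where "s = r / (2 * lp_norm p y)"
    have s: "0 < s" "s * lp_norm p y = r / 2"
      using pos y0 by (simp_all add: s_def)
    define sc where "sc t z = (\<lambda>n. t *\<^sub>R z n)" for t and z :: "int \<Rightarrow> 'a"
    have sc_lp: "sc t z \<in> lp_space p" "lp_norm p (sc t z) = \<bar>t\<bar> * lp_norm p z"
      if "z \<in> lp_space p" for t z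
      using lp_scaleR[OF p_ge_1 that] by (simp_all add: sc_def)
    have "lp_norm p (sc s y) < r"
      using s y0 sc_lp(2)[OF y] by simp
    then obtain u v where uv: "u \<in> M" "v \<in> N" "lp_norm p u \<le> 2 * k" "lp_norm p v \<le> 2 * k"
      "lp_norm p (sc s y - (u + v)) \<le> 2 * (r / 8)"
      using approx[of "sc s y" "r / 8"] sc_lp(1)[OF y] y0 by auto
    have uv_lp: "u \<in> lp_space p" "v \<in> lp_space p"
      using uv M(2) N(2) by blast+
    have "inverse s * (2 * k) \<le> \<kappa> * lp_norm p y"
      using pos y0 by (simp add: s_def \<kappa>_def field_simps)
    then have "lp_norm p (sc (inverse s) u) \<le> \<kappa> * lp_norm p y"
      "lp_norm p (sc (inverse s) v) \<le> \<kappa> * lp_norm p y"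
      using s order_trans[OF mult_left_mono[OF uv(3)]] order_trans[OF mult_left_mono[OF uv(4)]]
      unfolding sc_lp(2)[OF uv_lp(1)] sc_lp(2)[OF uv_lp(2)] by (simp_all add: abs_of_pos)
    moreover have "lp_norm p (y - (sc (inverse s) u + sc (inverse s) v)) \<le> lp_norm p y / 2"
    proof -
      have rest_lp: "sc s y - (u + v) \<in> lp_space p"
        by (intro lp_diff(1) lp_add(1) p_ge_1 sc_lp(1) y uv_lp)
      have "y - (sc (inverse s) u + sc (inverse s) v) = sc (inverse s) (sc s y - (u + v))"
        using s by (simp add: sc_def fun_eq_iff algebra_simps)
      then have "lp_norm p (y - (sc (inverse s) u + sc (inverse s) v))
          = lp_norm p (sc (inverse s) (sc s y - (u + v)))"
        by (rule arg_cong)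
      also have "\<dots> = inverse s * lp_norm p (sc s y - (u + v))"
        using s sc_lp(2)[OF rest_lp, of "inverse s"] by simp
      also have "\<dots> \<le> inverse s * (2 * (r / 8))"
        using s uv by (intro mult_left_mono) auto
      also have "\<dots> = lp_norm p y / 2"
        using pos y0 by (simp add: s_def field_simps)
      finally show ?thesis .
    qed
    moreover have "sc (inverse s) u \<in> M" "sc (inverse s) v \<in> N"
      using subspace_scaleR uv M(1) N(1) by (simp_all add: sc_def)
    ultimately show ?thesis
      by blast
  qed
  ultimately show ?thesis
    using that by blast
qed

text \<open>Iterating the approximation, the errors \<open>e i\<close> are halved each time, so the accumulated parts form
convergent series in \<open>M\<close> and in \<open>N\<close>, whose sums add up to \<open>y\<close>. Closedness of the subspaces enters
here.\<close>

proposition bounded_decomposition: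
  assumes M: "closed_subspace (seq_scale scl) (lp_space p) (lp_norm p) M"
    and N: "closed_subspace (seq_scale scl) (lp_space p) (lp_norm p) N"
    and sum: "{u + v |u v. u \<in> M \<and> v \<in> N} = lp_space p"
  obtains \<kappa> where "0 < \<kappa>"
    and "\<And>y. y \<in> lp_space p \<Longrightarrow>
      \<exists>u\<in>M. \<exists>v\<in>N. y = u + v \<and> lp_norm p u \<le> \<kappa> * lp_norm p y \<and> lp_norm p v \<le> \<kappa> * lp_norm p y"
proof -
  have sub: "seq.subspace M" "seq.subspace N"
    and lp: "M \<subseteq> lp_space p" "N \<subseteq> lp_space p"
    using M N closedin_subset[of lp.mtopology] by (auto simp: closed_subspace_def)
  obtain \<kappa> where "0 < \<kappa>"
    and \<kappa>: "\<And>y. y \<in> lp_space p \<Longrightarrow> \<exists>u\<in>M. \<exists>v\<in>N. lp_norm p u \<le> \<kappa> * lp_norm p y \<and>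
      lp_norm p v \<le> \<kappa> * lp_norm p y \<and> lp_norm p (y - (u + v)) \<le> lp_norm p y / 2"
    by (rule approximate_bounded_decomposition[OF sub(1) lp(1) sub(2) lp(2) sum]) blast
  obtain U V where UV: "\<And>y. y \<in> lp_space p \<Longrightarrow> U y \<in> M \<and> V y \<in> N \<and>
      lp_norm p (U y) \<le> \<kappa> * lp_norm p y \<and> lp_norm p (V y) \<le> \<kappa> * lp_norm p y \<and>
      lp_norm p (y - (U y + V y)) \<le> lp_norm p y / 2"
    using \<kappa> by metis
  have "\<exists>u\<in>M. \<exists>v\<in>N. y = u + v \<and> lp_norm p u \<le> 2 * \<kappa> * lp_norm p y \<and>
      lp_norm p v \<le> 2 * \<kappa> * lp_norm p y"
    if y: "y \<in> lp_space p" for y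
  proof -
    define e where "e i = ((\<lambda>z. z - (U z + V z)) ^^ i) y" for i
    have e_Suc: "e (Suc i) = e i - (U (e i) + V (e i))" for i
      by (simp add: e_def)
    have e: "e i \<in> lp_space p \<and> lp_norm p (e i) \<le> lp_norm p y * (1 / 2) ^ i" for i
    proof (induction i)
      case 0
      then show ?case
        using y by (simp add: e_def)
    next
      case (Suc i)
      have UVi: "U (e i) \<in> lp_space p" "V (e i) \<in> lp_space p"
        using UV[of "e i"] Suc.IH lp by blast+
      have "e (Suc i) \<in> lp_space p"
        unfolding e_Suc using Suc.IH UVi by (intro lp_diff(1) lp_add(1) p_ge_1) blast+
      moreover have "lp_norm p (e (Suc i)) \<le> lp_norm p (e i) / 2"
        unfolding e_Suc using UV[of "e i"] Suc.IH by blast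
      ultimately show ?case
        using Suc.IH by simp
    qed
    define \<beta> where "\<beta> i = \<kappa> * lp_norm p y * (1 / 2) ^ i" for i :: nat
    have \<beta>: "summable \<beta>" "suminf \<beta> = 2 * \<kappa> * lp_norm p y"
      unfolding \<beta>_def by (simp_all add: suminf_mult suminf_geometric)
    have "\<kappa> * lp_norm p (e i) \<le> \<beta> i" for i
      using e[of i] \<open>0 < \<kappa>\<close> by (simp add: \<beta>_def)
    then have U: "U (e i) \<in> M" "lp_norm p (U (e i)) \<le> \<beta> i"
      and V: "V (e i) \<in> N" "lp_norm p (V (e i)) \<le> \<beta> i" for i
      using UV[of "e i"] e[of i] by (auto intro: order_trans)
    have U_lp: "U (e i) \<in> lp_space p" and V_lp: "V (e i) \<in> lp_space p" for i
      using U V lp by blast+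
    define u v where "u = (\<lambda>n. \<Sum>i. U (e i) n)" and "v = (\<lambda>n. \<Sum>i. V (e i) n)"
    have "u \<in> M" "v \<in> N"
      unfolding u_def v_def
      using closed_subspace_suminf[OF M U \<beta>(1)] closed_subspace_suminf[OF N V \<beta>(1)] by blast+
    moreover have "lp_norm p u \<le> 2 * \<kappa> * lp_norm p y" "lp_norm p v \<le> 2 * \<kappa> * lp_norm p y"
      using lp_suminf(3)[OF p_ge_1 U_lp U(2) \<beta>(1)] lp_suminf(3)[OF p_ge_1 V_lp V(2) \<beta>(1)] \<beta>(2)
      by (simp_all add: u_def v_def)
    moreover have "y = u + v"
    proof
      fix n
      have "(\<lambda>i. (1 / 2) ^ i :: real) \<longlonglongrightarrow> 0"
        by (rule LIMSEQ_realpow_zero) auto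
      then have "(\<lambda>i. lp_norm p y * (1 / 2) ^ i) \<longlonglongrightarrow> 0"
        by (rule tendsto_mult_right_zero)
      moreover have "norm (e i n) \<le> lp_norm p y * (1 / 2) ^ i" for i
        using norm_le_lp_norm[OF p_ge_1, of "e i" n] e[of i] by linarith
      ultimately have e_lim: "(\<lambda>i. e i n) \<longlonglongrightarrow> 0"
        by (intro Lim_null_comparison[of "\<lambda>i. e i n" "\<lambda>i. lp_norm p y * (1 / 2) ^ i"]) simp_all
      have "y n - e m n = (\<Sum>i<m. U (e i) n + V (e i) n)" for m
        by (induction m) (simp_all add: e_Suc e_def[of 0] algebra_simps)
      moreover have "(\<lambda>m. y n - e m n) \<longlonglongrightarrow> y n - 0"
        by (intro tendsto_diff tendsto_const e_lim)
      ultimately have "(\<lambda>i. U (e i) n + V (e i) n) sums y n"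
        by (simp add: sums_def)
      moreover have "(\<lambda>i. U (e i) n + V (e i) n) sums (u n + v n)"
        unfolding u_def v_def
        using lp_suminf(1)[OF p_ge_1 U_lp U(2) \<beta>(1)] lp_suminf(1)[OF p_ge_1 V_lp V(2) \<beta>(1)]
        by (intro sums_add summable_sums)
      ultimately show "y n = (u + v) n"
        using sums_unique2 by fastforce
    qed
    ultimately show ?thesis
      by blast
  qed
  then show ?thesis
    using that[of "2 * \<kappa>"] \<open>0 < \<kappa>\<close> by simp
qed

end


section \<open>Shift operators and exponential splittings\<close>

locale lp_shift = lp_over scl p
  for scl :: "'k::real_or_complex \<Rightarrow> 'a::banach \<Rightarrow> 'a" and p :: real +
  fixes S :: "int \<Rightarrow> 'a \<Rightarrow> 'a" and C0 :: real
  assumes invertible: "invertible_operator scl (S n)"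
    and C0_pos: "0 < C0"
    and onorm_S: "onorm (S n) < C0" "onorm (inv (S n)) < C0"
begin

text \<open>An inverse of \<^const>\<open>shift_op\<close> on all sequences; it agrees with the inverse relative to
\<open>\<ell>\<^sub>p\<close>, and its powers are easier to compute.\<close>

definition unshift :: "(int \<Rightarrow> 'a) \<Rightarrow> int \<Rightarrow> 'a" where
  "unshift x = (\<lambda>n. inv (S n) (x (n - 1)))"

lemma bounded_linear_S: "bounded_linear (S n)" "bounded_linear (inv (S n))"
  using invertible[of n] by (auto simp: invertible_operator_def)

lemma bij_S: "bij (S n)"
  using invertible[of n] by (simp add: invertible_operator_def)

lemma inv_S_S [simp]: "inv (S n) (S n v) = v" "S n (inv (S n) v) = v"
  using bij_S[of n] by (auto simp: bij_def inv_f_f surj_f_inv_f)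

lemma norm_S: "norm (S n v) \<le> C0 * norm v" "norm (inv (S n) v) \<le> C0 * norm v"
  using onorm[OF bounded_linear_S(1), of n v] onorm[OF bounded_linear_S(2), of n v]
    mult_right_mono[OF less_imp_le[OF onorm_S(1)[of n]] norm_ge_zero[of v]]
    mult_right_mono[OF less_imp_le[OF onorm_S(2)[of n]] norm_ge_zero[of v]]
  by linarith+

lemma shift_unshift [simp]: "shift_op S (unshift x) = x" "unshift (shift_op S x) = x"
  by (simp_all add: shift_op_def unshift_def)

lemma shift_op_lp:
  assumes "x \<in> lp_space p"
  shows "shift_op S x \<in> lp_space p" "lp_norm p (shift_op S x) \<le> C0 * lp_norm p x"
  using lp_norm_dominated[OF p_ge_1 less_imp_le[OF C0_pos] _ assms,
      where \<pi> = "\<lambda>n. n + 1" and y = "shift_op S x"] norm_S(1)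
  by (auto simp: shift_op_def inj_def)

lemma unshift_lp:
  assumes "x \<in> lp_space p"
  shows "unshift x \<in> lp_space p" "lp_norm p (unshift x) \<le> C0 * lp_norm p x"
  using lp_norm_dominated[OF p_ge_1 less_imp_le[OF C0_pos] _ assms,
      where \<pi> = "\<lambda>n. n - 1" and y = "unshift x"] norm_S(2)
  by (auto simp: unshift_def inj_def)

lemma inv_into_shift_op:
  assumes "y \<in> lp_space p"
  shows "inv_into (lp_space p) (shift_op S) y = unshift y"
proof (rule inv_into_f_eq)
  show "inj_on (shift_op S) (lp_space p)"
    by (rule inj_on_inverseI[of _ unshift]) simp
qed (simp_all add: unshift_lp assms)

lemma shift_op_scaleR: "shift_op S (\<lambda>n. r *\<^sub>R x n) = (\<lambda>n. r *\<^sub>R shift_op S x n)"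
  by (simp add: shift_op_def linear_simps[OF bounded_linear_S(1)])

lemma unshift_scaleR: "unshift (\<lambda>n. r *\<^sub>R x n) = (\<lambda>n. r *\<^sub>R unshift x n)"
  by (simp add: unshift_def linear_simps[OF bounded_linear_S(2)])

text \<open>The same \<open>C\<close> and \<open>\<theta>\<close> serve both subspaces; for finitely many decay rates this is no restriction,
by taking maxima.\<close>

definition exponential_splitting ::
    "(int \<Rightarrow> 'a) set \<Rightarrow> (int \<Rightarrow> 'a) set \<Rightarrow> real \<Rightarrow> real \<Rightarrow> bool" where
  "exponential_splitting M N C \<theta> \<longleftrightarrow>
     closed_subspace (seq_scale scl) (lp_space p) (lp_norm p) M \<and>
     closed_subspace (seq_scale scl) (lp_space p) (lp_norm p) N \<and>
     M \<inter> N = {0} \<and> {u + v |u v. u \<in> M \<and> v \<in> N} = lp_space p \<and>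
     shift_op S ` M \<subseteq> M \<and> unshift ` N \<subseteq> N \<and> 0 < C \<and> 0 < \<theta> \<and> \<theta> < 1 \<and>
     (\<forall>n. \<forall>u\<in>M. lp_norm p ((shift_op S ^^ n) u) \<le> C * \<theta> ^ n * lp_norm p u) \<and>
     (\<forall>n. \<forall>v\<in>N. lp_norm p ((unshift ^^ n) v) \<le> C * \<theta> ^ n * lp_norm p v)"

lemma closed_subspaceD:
  assumes "closed_subspace (seq_scale scl) (lp_space p) (lp_norm p) M"
  shows "seq.subspace M" "M \<subseteq> lp_space p"
  using assms closedin_subset[of lp.mtopology M] by (auto simp: closed_subspace_def)

text \<open>Apart from replacing the relative inverse by \<^const>\<open>unshift\<close>, this is the equivalence of
spectral radius below one and geometric decay, on each of the two subspaces.\<close>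

proposition generalized_hyperbolic_iff_splitting:
  "generalized_hyperbolic (seq_scale scl) (lp_space p) (lp_norm p) (shift_op S) \<longleftrightarrow>
   (\<exists>M N C \<theta>. exponential_splitting M N C \<theta>)"
proof -
  let ?T = "shift_op S" and ?R = "inv_into (lp_space p) (shift_op S)"
  have T: "restricted_operator (lp_norm p) (\<lambda>r y n. r *\<^sub>R y n) M ?T C0"
    if M: "closed_subspace (seq_scale scl) (lp_space p) (lp_norm p) M" and TM: "?T ` M \<subseteq> M" for M
  proof
    note sub = closed_subspaceD[OF M]
    show "M \<noteq> {}"
      using seq.subspace_0[OF sub(1)] by blast
    fix y r assume y: "y \<in> M"
    then have "y \<in> lp_space p"
      using sub by blast
    then show "lp_norm p (\<lambda>n. r *\<^sub>R y n) = \<bar>r\<bar> * lp_norm p y" "lp_norm p (?T y) \<le> C0 * lp_norm p y"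
      by (rule lp_scaleR(2)[OF p_ge_1] shift_op_lp(2))+
  qed (use M TM C0_pos closed_subspaceD subspace_scaleR shift_op_scaleR in
      \<open>auto simp: lp_norm_nonneg\<close>)
  have R: "restricted_operator (lp_norm p) (\<lambda>r y n. r *\<^sub>R y n) N ?R C0"
    if N: "closed_subspace (seq_scale scl) (lp_space p) (lp_norm p) N" and RN: "?R ` N \<subseteq> N" for N
  proof
    note sub = closed_subspaceD[OF N]
    show "N \<noteq> {}"
      using seq.subspace_0[OF sub(1)] by blast
    fix y r assume y: "y \<in> N"
    then have y_lp: "y \<in> lp_space p"
      using sub by blast
    then show "lp_norm p (\<lambda>n. r *\<^sub>R y n) = \<bar>r\<bar> * lp_norm p y"
      by (rule lp_scaleR(2)[OF p_ge_1])
    show "lp_norm p (?R y) \<le> C0 * lp_norm p y"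
      using y_lp by (simp add: inv_into_shift_op unshift_lp)
    show "?R (\<lambda>n. r *\<^sub>R y n) = (\<lambda>n. r *\<^sub>R ?R y n)"
      using y_lp lp_scaleR(1)[OF p_ge_1 y_lp, of r] by (simp add: inv_into_shift_op unshift_scaleR)
  qed (use N RN C0_pos closed_subspaceD subspace_scaleR in \<open>auto simp: lp_norm_nonneg\<close>)
  have R_pow: "(?R ^^ n) y = (unshift ^^ n) y" if "y \<in> lp_space p" for n y
  proof -
    have "(?R ^^ n) y = (unshift ^^ n) y \<and> (unshift ^^ n) y \<in> lp_space p"
      by (induction n) (auto simp: that inv_into_shift_op unshift_lp)
    then show ?thesis ..
  qed
  have R_image: "?R ` N = unshift ` N" if "N \<subseteq> lp_space p" for N
    using that inv_into_shift_op by (intro image_cong) auto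
  show ?thesis
  proof
    assume "generalized_hyperbolic (seq_scale scl) (lp_space p) (lp_norm p) ?T"
    then obtain M N where
      M: "closed_subspace (seq_scale scl) (lp_space p) (lp_norm p) M" "?T ` M \<subseteq> M" and
      N: "closed_subspace (seq_scale scl) (lp_space p) (lp_norm p) N" "?R ` N \<subseteq> N" and
      MN: "M \<inter> N = {0}" "{u + v |u v. u \<in> M \<and> v \<in> N} = lp_space p" and
      radii: "\<exists>r<1. has_spectral_radius_on (lp_norm p) M ?T r"
        "\<exists>r<1. has_spectral_radius_on (lp_norm p) N ?R r"
      unfolding generalized_hyperbolic_def 
      by (elim exE) (elim conjE, rule that, assumption+)
    obtain C1 \<theta>1 where 1: "0 < C1" "0 < \<theta>1" "\<theta>1 < 1"
      "\<And>n y. y \<in> M \<Longrightarrow> lp_norm p ((?T ^^ n) y) \<le> C1 * \<theta>1 ^ n * lp_norm p y"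
      using radii(1) unfolding restricted_operator.spectral_radius_less_1_iff[OF T[OF M]] by blast
    obtain C2 \<theta>2 where 2: "0 < C2" "0 < \<theta>2" "\<theta>2 < 1"
      "\<And>n y. y \<in> N \<Longrightarrow> lp_norm p ((?R ^^ n) y) \<le> C2 * \<theta>2 ^ n * lp_norm p y"
      using radii(2) unfolding restricted_operator.spectral_radius_less_1_iff[OF R[OF N]] by blast
    define C \<theta> where "C = max C1 C2" and "\<theta> = max \<theta>1 \<theta>2"
    have le: "C1 * \<theta>1 ^ n * lp_norm p y \<le> C * \<theta> ^ n * lp_norm p y"
      "C2 * \<theta>2 ^ n * lp_norm p y \<le> C * \<theta> ^ n * lp_norm p y" for n and y :: "int \<Rightarrow> 'a"
      using 1 2 by (auto intro!: mult_right_mono mult_mono power_mono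
          simp: C_def \<theta>_def lp_norm_nonneg le_max_iff_disj)
    have "lp_norm p ((?T ^^ n) u) \<le> C * \<theta> ^ n * lp_norm p u" if "u \<in> M" for n u
      using 1(4)[OF that] le(1) by (rule order_trans)
    moreover have "lp_norm p ((unshift ^^ n) v) \<le> C * \<theta> ^ n * lp_norm p v" if "v \<in> N" for n v
      using order_trans[OF 2(4)[OF that, of n] le(2)] R_pow[of v n] that closed_subspaceD(2)[OF N(1)]
      by auto
    ultimately have "exponential_splitting M N C \<theta>"
      using M N MN 1 2 R_image[OF closed_subspaceD(2)[OF N(1)]]
      unfolding exponential_splitting_def by (simp add: C_def \<theta>_def less_max_iff_disj)
    then show "\<exists>M N C \<theta>. exponential_splitting M N C \<theta>"
      by blast
  next
    assume "\<exists>M N C \<theta>. exponential_splitting M N C \<theta>"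
    then obtain M N C \<theta> where split: "exponential_splitting M N C \<theta>"
      by blast
    then have M: "closed_subspace (seq_scale scl) (lp_space p) (lp_norm p) M" "?T ` M \<subseteq> M"
      and N: "closed_subspace (seq_scale scl) (lp_space p) (lp_norm p) N" "unshift ` N \<subseteq> N"
      by (auto simp: exponential_splitting_def)
    have N': "?R ` N \<subseteq> N"
      using N R_image[OF closed_subspaceD(2)[OF N(1)]] by simp
    have decay: "lp_norm p ((?R ^^ n) y) \<le> C * \<theta> ^ n * lp_norm p y" if "y \<in> N" for n y
      using R_pow[of y n] split that closed_subspaceD(2)[OF N(1)]
      by (auto simp: exponential_splitting_def)
    have "\<exists>r<1. has_spectral_radius_on (lp_norm p) M ?T r"
      unfolding restricted_operator.spectral_radius_less_1_iff[OF T[OF M]]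
      using split by (intro exI[of _ C] exI[of _ \<theta>]) (simp add: exponential_splitting_def)
    moreover have "\<exists>r<1. has_spectral_radius_on (lp_norm p) N ?R r"
      unfolding restricted_operator.spectral_radius_less_1_iff[OF R[OF N(1) N']]
      using split decay by (intro exI[of _ C] exI[of _ \<theta>]) (simp add: exponential_splitting_def)
    ultimately show "generalized_hyperbolic (seq_scale scl) (lp_space p) (lp_norm p) ?T"
      unfolding generalized_hyperbolic_def using split M N N'
      by (intro exI[of _ M] exI[of _ N]) (simp add: exponential_splitting_def)
  qed
qed


section \<open>Splittings yield shadowing\<close>

text \<open>With \<open>T\<close> the shift and \<open>z\<^sub>n = u\<^sub>n + v\<^sub>n\<close>, the solution is
\<open>x\<^sub>n = (\<Sum>k\<ge>0. T\<^sup>k u\<^sub>n\<^sub>-\<^sub>1\<^sub>-\<^sub>k) - (\<Sum>k\<ge>0. T\<^sup>-\<^sup>k\<^sup>-\<^sup>1 v\<^sub>n\<^sub>+\<^sub>k)\<close>: past errors in the contracted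
direction and future errors in the expanded one. Applying \<open>T\<close> shifts the index in both series,
and what remains of \<open>x\<^sub>n\<^sub>+\<^sub>1 - T x\<^sub>n\<close> are the two terms \<open>u\<^sub>n\<close> and \<open>v\<^sub>n\<close>. The sums are entrywise, so it
suffices that each \<open>S\<^sub>j\<close> is continuous.\<close>

proposition exponential_splitting_imp_shadowing:
  assumes split: "exponential_splitting M N C \<theta>"
  shows "shadowing_property (lp_space p) (lp_norm p) (shift_op S)"
proof -
  let ?T = "shift_op S"
  have M: "closed_subspace (seq_scale scl) (lp_space p) (lp_norm p) M"
    and N: "closed_subspace (seq_scale scl) (lp_space p) (lp_norm p) N"
    and sum: "{u + v |u v. u \<in> M \<and> v \<in> N} = lp_space p"
    and C: "0 < C" and \<theta>: "0 < \<theta>" "\<theta> < 1"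
    and decay: "\<And>n u. u \<in> M \<Longrightarrow> lp_norm p ((?T ^^ n) u) \<le> C * \<theta> ^ n * lp_norm p u"
      "\<And>n v. v \<in> N \<Longrightarrow> lp_norm p ((unshift ^^ n) v) \<le> C * \<theta> ^ n * lp_norm p v"
    using split by (simp_all add: exponential_splitting_def)
  obtain \<kappa> where "0 < \<kappa>" and \<kappa>: "\<And>y. y \<in> lp_space p \<Longrightarrow>
      \<exists>u\<in>M. \<exists>v\<in>N. y = u + v \<and> lp_norm p u \<le> \<kappa> * lp_norm p y \<and> lp_norm p v \<le> \<kappa> * lp_norm p y"
    by (rule bounded_decomposition[OF M N sum]) blast
  define K where "K = 2 * (C * \<kappa> / (1 - \<theta>))"
  have "0 < K"
    using C \<open>0 < \<kappa>\<close> \<theta> by (simp add: K_def)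
  moreover have "\<exists>x. bounded_seq_in (lp_space p) (lp_norm p) x \<and>
      (\<forall>n. x (n + 1) - ?T (x n) = z n) \<and> (SUP n. lp_norm p (x n)) \<le> K * (SUP n. lp_norm p (z n))"
    if z: "bounded_seq_in (lp_space p) (lp_norm p) z" for z
  proof -
    define Z where "Z = (SUP n. lp_norm p (z n))"
    have z_lp: "z n \<in> lp_space p" and z_le: "lp_norm p (z n) \<le> Z" for n
      using z by (auto simp: bounded_seq_in_def Z_def intro: cSUP_upper)
    have "0 \<le> Z"
      using z_le[of 0] lp_norm_nonneg[of p "z 0"] by linarith
    obtain u v where uv: "\<And>n. u n \<in> M" "\<And>n. v n \<in> N" "\<And>n. z n = u n + v n"
      "\<And>n. lp_norm p (u n) \<le> \<kappa> * lp_norm p (z n)" "\<And>n. lp_norm p (v n) \<le> \<kappa> * lp_norm p (z n)"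
      using \<kappa>[OF z_lp] by metis
    have uv_le: "lp_norm p (u n) \<le> \<kappa> * Z" "lp_norm p (v n) \<le> \<kappa> * Z" for n
      using uv(4,5)[of n] mult_left_mono[OF z_le[of n], of \<kappa>] \<open>0 < \<kappa>\<close> by linarith+
    have uv_lp: "u n \<in> lp_space p" "v n \<in> lp_space p" for n
      using uv(1,2)[of n] closed_subspaceD(2)[OF M] closed_subspaceD(2)[OF N] by blast+
    have pow_lp: "(?T ^^ k) y \<in> lp_space p" "(unshift ^^ k) y \<in> lp_space p"
      if "y \<in> lp_space p" for k y
      by (induction k) (auto simp: that shift_op_lp unshift_lp)
    define a where "a n k = (?T ^^ k) (u (n - 1 - int k))" for n k
    define b where "b n k = (unshift ^^ Suc k) (v (n + int k))" for n k
    define \<beta> where "\<beta> k = C * \<kappa> * Z * \<theta> ^ k" for k :: nat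
    have \<beta>: "summable \<beta>" "suminf \<beta> = C * \<kappa> * Z / (1 - \<theta>)"
      using \<theta> unfolding \<beta>_def by (simp_all add: suminf_mult suminf_geometric)
    have a: "a n k \<in> lp_space p" "lp_norm p (a n k) \<le> \<beta> k" for n k
    proof -
      show "a n k \<in> lp_space p"
        unfolding a_def by (intro pow_lp uv_lp)
      have "lp_norm p (a n k) \<le> C * \<theta> ^ k * lp_norm p (u (n - 1 - int k))"
        unfolding a_def by (intro decay uv)
      also have "\<dots> \<le> C * \<theta> ^ k * (\<kappa> * Z)"
        using C \<theta> by (intro mult_left_mono uv_le) auto
      finally show "lp_norm p (a n k) \<le> \<beta> k"
        by (simp add: \<beta>_def mult_ac)
    qed
    have b: "b n k \<in> lp_space p" "lp_norm p (b n k) \<le> \<beta> k" for n k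
    proof -
      show "b n k \<in> lp_space p"
        unfolding b_def by (intro pow_lp uv_lp)
      have "lp_norm p (b n k) \<le> C * \<theta> ^ Suc k * lp_norm p (v (n + int k))"
        unfolding b_def by (intro decay uv)
      also have "\<dots> \<le> C * \<theta> ^ k * (\<kappa> * Z)"
        using C \<theta> power_decreasing[of k "Suc k" \<theta>] uv_le \<open>0 \<le> Z\<close> \<open>0 < \<kappa>\<close>
        by (intro mult_mono mult_left_mono) (auto simp: lp_norm_nonneg)
      finally show "lp_norm p (b n k) \<le> \<beta> k"
        by (simp add: \<beta>_def mult_ac)
    qed
    note sum_a = lp_suminf[OF p_ge_1 a \<beta>(1)] and sum_b = lp_suminf[OF p_ge_1 b \<beta>(1)]
    define x where "x n = (\<lambda>j. \<Sum>k. a n k j) - (\<lambda>j. \<Sum>k. b n k j)" for n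
    have x_lp: "x n \<in> lp_space p" for n
      unfolding x_def by (intro lp_diff p_ge_1 sum_a sum_b)
    have x_le: "lp_norm p (x n) \<le> K * Z" for n
    proof -
      have "lp_norm p (x n) \<le> suminf \<beta> + suminf \<beta>"
        unfolding x_def
        by (rule order_trans[OF lp_diff(2)[OF p_ge_1 sum_a(2) sum_b(2)]])
          (intro add_mono sum_a sum_b)
      then show ?thesis
        by (simp add: \<beta> K_def mult_ac)
    qed
    have "x (n + 1) - ?T (x n) = z n" for n
    proof
      fix j
      have Ta: "?T (a n k) = a (n + 1) (Suc k)" for k
        by (simp add: a_def diff_diff_eq)
      have Tb: "?T (b n 0) = v n" "?T (b n (Suc k)) = b (n + 1) k" for k
        by (simp_all add: b_def add_ac)
      have "?T (x n) j = S (j + 1) (\<Sum>k. a n k (j + 1)) - S (j + 1) (\<Sum>k. b n k (j + 1))"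
        by (simp add: shift_op_def x_def linear_simps[OF bounded_linear_S(1)])
      also have "S (j + 1) (\<Sum>k. a n k (j + 1)) = (\<Sum>k. ?T (a n k) j)"
        unfolding shift_op_def by (rule bounded_linear.suminf[OF bounded_linear_S(1) sum_a(1)])
      also have "\<dots> = (\<Sum>k. a (n + 1) k j) - u n j"
        using suminf_split_head[of "\<lambda>k. a (n + 1) k j", OF sum_a(1)] by (simp add: Ta a_def[of _ 0])
      also have "S (j + 1) (\<Sum>k. b n k (j + 1)) = (\<Sum>k. ?T (b n k) j)"
        unfolding shift_op_def by (rule bounded_linear.suminf[OF bounded_linear_S(1) sum_b(1)])
      also have "\<dots> = v n j + (\<Sum>k. b (n + 1) k j)"
      proof -
        have "summable (\<lambda>k. ?T (b n k) j)"
          unfolding shift_op_def by (rule bounded_linear.summable[OF bounded_linear_S(1) sum_b(1)])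
        from suminf_split_head[OF this] show ?thesis
          by (simp add: Tb)
      qed
      finally have Tx: "?T (x n) j =
          (\<Sum>k. a (n + 1) k j) - u n j - (v n j + (\<Sum>k. b (n + 1) k j))" .
      have "x (n + 1) j = (\<Sum>k. a (n + 1) k j) - (\<Sum>k. b (n + 1) k j)"
        by (simp add: x_def)
      with Tx show "(x (n + 1) - ?T (x n)) j = z n j"
        by (simp add: uv(3))
    qed
    moreover have "bounded_seq_in (lp_space p) (lp_norm p) x"
      using x_lp x_le by (auto simp: bounded_seq_in_def intro!: bdd_aboveI[of _ "K * Z"])
    moreover have "(SUP n. lp_norm p (x n)) \<le> K * Z"
      using x_le by (intro cSUP_least) auto
    ultimately show ?thesis
      unfolding Z_def by blast
  qed
  ultimately show ?thesis
    unfolding shadowing_property_def by blast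
qed

end


section \<open>Dichotomy of a positive scalar cocycle\<close>

text \<open>The real part, transported to the scalar field. That the embedding fixes the reals follows from
the isometry alone: a complex \<open>z\<close> with \<open>\<bar>z\<bar> = \<bar>r\<bar>\<close> and \<open>\<bar>z - 1\<bar> = \<bar>r - 1\<bar>\<close> has real part \<open>r\<close>.\<close>

lemma real_part_functional:
  obtains \<rho> :: "'k::real_or_complex \<Rightarrow> real"
  where "\<And>a b. \<rho> (a - b) = \<rho> a - \<rho> b" "\<And>r. \<rho> (of_real r) = r" "\<And>a. \<bar>\<rho> a\<bar> \<le> norm a"
proof -
  obtain f :: "'k \<Rightarrow> complex" where add: "\<And>a b. f (a + b) = f a + f b"
    and mult: "\<And>a b. f (a * b) = f a * f b" and norm: "\<And>a. cmod (f a) = norm a"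
    using ex_isometric_embedding_complex by blast
  have diff: "f (a - b) = f a - f b" for a b
    using add[of "a - b" b] by simp
  have "f 1 \<noteq> 0"
    using norm[of 1] by auto
  then have "f 1 = 1"
    using mult[of 1 1] by simp
  have "Re (f (of_real r)) = r" for r
  proof -
    define z where "z = f (of_real r)"
    have "cmod z = \<bar>r\<bar>"
      by (simp add: z_def norm)
    then have 1: "(Re z)\<^sup>2 + (Im z)\<^sup>2 = r\<^sup>2"
      by (metis cmod_power2 power2_abs)
    have "z - 1 = f (of_real (r - 1))"
      by (simp add: z_def diff \<open>f 1 = 1\<close>)
    then have "cmod (z - 1) = \<bar>r - 1\<bar>"
      by (simp only: norm norm_of_real)
    then have "(Re (z - 1))\<^sup>2 + (Im (z - 1))\<^sup>2 = (r - 1)\<^sup>2"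
      by (metis cmod_power2 power2_abs)
    then have "Re z = r"
      using 1 by (simp add: power2_eq_square algebra_simps)
    then show ?thesis
      by (simp add: z_def)
  qed
  moreover have "\<bar>Re (f a)\<bar> \<le> norm a" for a
    using abs_Re_le_cmod[of "f a"] norm by simp
  ultimately show ?thesis
    using that[of "\<lambda>a. Re (f a)"] by (simp add: diff)
qed

text \<open>For \<open>a j = u j * g j\<close> this says that \<open>a (j - 1) = (g (j - 1) / g j) * a j + 1\<close> and
\<open>\<bar>a j\<bar> \<le> K\<close>: a bounded solution, with constant forcing, of the scalar equation whose multipliers
are the ratios of \<open>g\<close>. The form in \<open>u\<close> comes directly from coordinates, and shows that \<open>u\<close> is
strictly decreasing in \<open>j\<close>.\<close>

definition bounded_solution :: "real \<Rightarrow> real \<Rightarrow> (int \<Rightarrow> real) \<Rightarrow> (int \<Rightarrow> real) \<Rightarrow> bool" where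
  "bounded_solution c K g u \<longleftrightarrow>
     (\<forall>j. 0 < g j \<and> g (j - 1) \<le> c * g j \<and> u (j - 1) - u j = 1 / g (j - 1) \<and> \<bar>u j\<bar> * g j \<le> K)"

text \<open>The dynamics moves positions to the left: on \<open>P\<close> the growth function decays towards \<open>-\<infinity>\<close>, off
\<open>P\<close> it decays towards \<open>+\<infinity>\<close>. The cases of \<open>P\<close> empty or full are the uniformly expanding and the
uniformly contracting one.\<close>

definition dichotomous :: "int set \<Rightarrow> real \<Rightarrow> real \<Rightarrow> (int \<Rightarrow> real) \<Rightarrow> bool" where
  "dichotomous P C \<theta> g \<longleftrightarrow>
     (\<forall>j\<in>P. j - 1 \<in> P) \<and>
     (\<forall>j\<in>P. \<forall>k. g (j - int k) \<le> C * \<theta> ^ k * g j) \<and>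
     (\<forall>j. j \<notin> P \<longrightarrow> (\<forall>k. g (j + int k) \<le> C * \<theta> ^ k * g j))"

text \<open>Put \<open>P = {j. 0 < u j}\<close>. The quantities \<open>A\<close> and \<open>B\<close> in the proof are the solution and its
negative, shifted to be bounded away from zero on \<open>P\<close> and off \<open>P\<close> respectively. Along \<open>A\<close> each
step of \<open>g\<close> to the left costs a factor: \<open>w A j \<le> \<theta> A (j - 1)\<close> for the multiplier
\<open>w = g (j - 1) / g j\<close>, because the forcing term is at least a fixed fraction of the
bounded \<open>A\<close>. The factors
\<open>A\<close> telescope in a product of multipliers, leaving \<open>\<theta>\<^sup>k\<close> times a ratio of two values of \<open>A\<close>. The
argument for \<open>B\<close> is the same with the direction reversed. All constants depend only on \<open>c\<close> and
\<open>K\<close>.\<close>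

proposition scalar_dichotomy:
  assumes c: "0 < c" and K: "0 < K"
  shows "\<exists>C \<theta>. 0 < C \<and> 0 < \<theta> \<and> \<theta> < 1 \<and>
    (\<forall>g u. bounded_solution c K g u \<longrightarrow> (\<exists>P. dichotomous P C \<theta> g))"
proof -
  \<comment> \<open>With \<open>\<delta> c = 1 / 2\<close>, the shift \<open>\<delta>\<close> of the solution uses up half of the forcing term \<open>1\<close>.
  The denominator in \<open>\<theta>\<close> is large enough for \<open>A \<le> K + \<delta>\<close> with forcing \<open>1 / 2\<close> and for
  \<open>B \<le> K + 1\<close> with forcing \<open>1\<close>, and its last summand makes \<open>\<theta>\<close> positive.\<close>
  define \<delta> where "\<delta> = 1 / (2 * c)"
  define \<theta> where "\<theta> = 1 - 1 / (2 * (K + \<delta>) + 1)"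
  define C where "C = (K + \<delta>) / \<delta> + (K + 1)"
  have \<delta>: "0 < \<delta>" "\<delta> * c = 1 / 2"
    using c by (simp_all add: \<delta>_def)
  have \<theta>: "0 < \<theta>" "\<theta> < 1"
    using K \<delta> by (simp_all add: \<theta>_def)
  have absorb: "x - t \<le> \<theta> * x" if "x \<le> t * (2 * (K + \<delta>) + 1)" for x t
  proof -
    have "x / (2 * (K + \<delta>) + 1) \<le> t"
      using that K \<delta> by (simp add: pos_divide_le_eq)
    then show ?thesis
      by (simp add: \<theta>_def left_diff_distrib)
  qed
  have C: "0 < C" "(K + \<delta>) / \<delta> \<le> C" "K + 1 \<le> C"
    using K \<delta> by (auto simp: C_def intro!: add_pos_pos divide_pos_pos)
  have dichotomy: "\<exists>P. dichotomous P C \<theta> g" if sol: "bounded_solution c K g u" for g u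
  proof -
    have g: "0 < g j" and g_step: "g (j - 1) \<le> c * g j"
      and u: "u (j - 1) - u j = 1 / g (j - 1)" and bound: "\<bar>u j\<bar> * g j \<le> K" for j
      using sol by (simp_all add: bounded_solution_def)
    define P where "P = {j. 0 < u j}"
    have P_down: "j - 1 \<in> P" if "j \<in> P" for j
    proof -
      have "0 < u j + 1 / g (j - 1)"
        using that g[of "j - 1"] by (intro add_pos_pos) (auto simp: P_def)
      then show ?thesis
        using u[of j] by (simp add: P_def)
    qed
    have ug: "u (j - 1) * g (j - 1) = u j * g (j - 1) + 1" for j
    proof -
      have "u (j - 1) = u j + 1 / g (j - 1)"
        using u[of j] by linarith
      then show ?thesis
        using g[of "j - 1"] by (simp add: distrib_right)
    qed
    have ug_le: "u j * g j \<le> K" "- (u j * g j) \<le> K" for j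
      using bound[of j] g[of j] abs_le_D1[of "u j * g j" K] abs_le_D2[of "u j * g j" K]
      by (simp_all add: abs_mult)
    define A where "A j = u j * g j + \<delta>" for j
    define B where "B j = 1 - u j * g j" for j
    have A_step: "g (j - 1) * A j \<le> \<theta> * A (j - 1) * g j" for j
    proof -
      have "g (j - 1) * A j = (u j * g (j - 1)) * g j + \<delta> * g (j - 1)"
        by (simp add: A_def algebra_simps)
      also have "\<dots> \<le> (u j * g (j - 1)) * g j + \<delta> * (c * g j)"
        using \<delta> g_step[of j] by simp
      also have "\<dots> = (u j * g (j - 1) + 1 / 2) * g j"
        using \<delta> by (simp add: distrib_right mult.assoc[symmetric])
      also have "\<dots> \<le> (A (j - 1) - 1 / 2) * g j"
        using \<delta> g[of j] ug[of j] by (intro mult_right_mono) (auto simp: A_def)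
      also have "\<dots> \<le> (\<theta> * A (j - 1)) * g j"
        using K \<delta> ug_le(1)[of "j - 1"] g[of j]
        by (intro mult_right_mono absorb) (auto simp: A_def algebra_simps)
      finally show ?thesis .
    qed
    have B_step: "g (j + 1) * B j \<le> \<theta> * B (j + 1) * g j" for j
    proof -
      have "g (j + 1) * B j = (B (j + 1) - 1) * g j"
      proof -
        have "u (j + 1) * g j = u j * g j - 1"
          using ug[of "j + 1"] by simp
        then have "(u (j + 1) * g j) * g (j + 1) = (u j * g j - 1) * g (j + 1)"
          by simp
        then show ?thesis
          by (simp add: B_def algebra_simps)
      qed
      also have "\<dots> \<le> (\<theta> * B (j + 1)) * g j"
        using K \<delta> ug_le(2)[of "j + 1"] g[of j]
        by (intro mult_right_mono absorb) (auto simp: B_def)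
      finally show ?thesis .
    qed
    have contract: "g (j - int k) \<le> C * \<theta> ^ k * g j" if "j \<in> P" for j k
    proof -
      have "j - int k \<in> P \<and> g (j - int k) * A j \<le> \<theta> ^ k * A (j - int k) * g j"
      proof (induction k)
        case (Suc k)
        let ?i = "j - int k"
        have "0 < A ?i"
          using Suc.IH g[of ?i] \<delta> by (auto simp: A_def P_def intro!: add_pos_pos)
        have "A ?i * (g (?i - 1) * A j) = (g (?i - 1) * A ?i) * A j"
          by simp
        also have "\<dots> \<le> (\<theta> * A (?i - 1) * g ?i) * A j"
          using that g[of j] \<delta> by (intro mult_right_mono A_step) (auto simp: A_def P_def)
        also have "\<dots> = (\<theta> * A (?i - 1)) * (g ?i * A j)"
          by simp
        also have "\<dots> \<le> (\<theta> * A (?i - 1)) * (\<theta> ^ k * A ?i * g j)"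
        proof -
          have "0 < A (?i - 1)"
            using P_down[of ?i] Suc.IH g[of "?i - 1"] \<delta> by (auto simp: A_def P_def intro!: add_pos_pos)
          then show ?thesis
            using Suc.IH \<theta> by (intro mult_left_mono) auto
        qed
        also have "\<dots> = A ?i * (\<theta> ^ Suc k * A (?i - 1) * g j)"
          by simp
        finally have "g (?i - 1) * A j \<le> \<theta> ^ Suc k * A (?i - 1) * g j"
          using \<open>0 < A ?i\<close> by (simp only: mult_le_cancel_left_pos)
        moreover have "j - int (Suc k) = ?i - 1"
          by simp
        ultimately show ?case
          using P_down[of ?i] Suc.IH by (simp only:)
      qed (use that in simp)
      then have "g (j - int k) * A j \<le> \<theta> ^ k * A (j - int k) * g j" ..
      also have "\<dots> \<le> \<theta> ^ k * (K + \<delta>) * g j"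
        using \<theta> g[of j] ug_le(1)[of "j - int k"]
        by (intro mult_right_mono mult_left_mono) (auto simp: A_def)
      finally have "g (j - int k) * A j \<le> \<theta> ^ k * (K + \<delta>) * g j" .
      moreover have "g (j - int k) * \<delta> \<le> g (j - int k) * A j"
        using that g[of j] g[of "j - int k"] by (intro mult_left_mono) (auto simp: A_def P_def)
      ultimately have "g (j - int k) * \<delta> \<le> \<theta> ^ k * (K + \<delta>) * g j"
        by linarith
      then have "g (j - int k) \<le> (K + \<delta>) / \<delta> * (\<theta> ^ k * g j)"
        using \<delta> by (simp add: field_simps)
      also have "\<dots> \<le> C * (\<theta> ^ k * g j)"
        using C \<theta> g[of j] by (intro mult_right_mono) auto
      finally show ?thesis
        by simp
    qed
    have expand: "g (j + int k) \<le> C * \<theta> ^ k * g j" if "j \<notin> P" for j k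
    proof -
      have B_ge: "1 \<le> B i" if "i \<notin> P" for i
        using that g[of i] by (simp add: B_def P_def mult_nonpos_nonneg)
      have "j + int k \<notin> P \<and> g (j + int k) * B j \<le> \<theta> ^ k * B (j + int k) * g j"
      proof (induction k)
        case (Suc k)
        let ?i = "j + int k"
        have up: "?i + 1 \<notin> P"
          using P_down[of "?i + 1"] Suc.IH by auto
        have "0 < B ?i"
          using B_ge[of ?i] Suc.IH by auto
        have "B ?i * (g (?i + 1) * B j) = (g (?i + 1) * B ?i) * B j"
          by simp
        also have "\<dots> \<le> (\<theta> * B (?i + 1) * g ?i) * B j"
          using B_ge[OF that] by (intro mult_right_mono B_step) auto
        also have "\<dots> = (\<theta> * B (?i + 1)) * (g ?i * B j)"
          by simp
        also have "\<dots> \<le> (\<theta> * B (?i + 1)) * (\<theta> ^ k * B ?i * g j)"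
          using Suc.IH \<theta> B_ge[OF up] by (intro mult_left_mono) auto
        also have "\<dots> = B ?i * (\<theta> ^ Suc k * B (?i + 1) * g j)"
          by simp
        finally have "g (?i + 1) * B j \<le> \<theta> ^ Suc k * B (?i + 1) * g j"
          using \<open>0 < B ?i\<close> by (simp only: mult_le_cancel_left_pos)
        moreover have "j + int (Suc k) = ?i + 1"
          by simp
        ultimately show ?case
          using up by metis
      qed (use that in simp)
      then have "g (j + int k) * B j \<le> \<theta> ^ k * B (j + int k) * g j" ..
      also have "\<dots> \<le> \<theta> ^ k * (K + 1) * g j"
        using \<theta> g[of j] ug_le(2)[of "j + int k"]
        by (intro mult_right_mono mult_left_mono) (auto simp: B_def)
      also have "\<dots> \<le> \<theta> ^ k * C * g j"
        using C \<theta> g[of j] by (intro mult_right_mono mult_left_mono) auto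
      finally have "g (j + int k) * B j \<le> \<theta> ^ k * C * g j" .
      moreover have "g (j + int k) * 1 \<le> g (j + int k) * B j"
        using B_ge[OF that] g[of "j + int k"] by (intro mult_left_mono) auto
      ultimately show ?thesis
        by (simp add: mult_ac)
    qed
    have "dichotomous P C \<theta> g"
      unfolding dichotomous_def by (intro conjI ballI allI impI P_down contract expand)
    then show ?thesis ..
  qed
  show ?thesis
    by (intro exI[of _ C] exI[of _ \<theta>] conjI allI impI C(1) \<theta> dichotomy)
qed


section \<open>The fundamental cocycle and its bounded projections\<close>

lemma comp_seg_empty: "m < n \<Longrightarrow> comp_seg S n m = id"
  by (simp add: comp_seg_def)

lemma comp_seg_first: "n \<le> m \<Longrightarrow> comp_seg S n m = S n \<circ> comp_seg S (n + 1) m"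
  by (simp add: comp_seg_def upto_rec1)

lemma comp_seg_last: "n \<le> m \<Longrightarrow> comp_seg S n m = comp_seg S n (m - 1) \<circ> S m"
proof -
  have foldr_comp: "foldr (\<circ>) fs f = foldr (\<circ>) fs id \<circ> f" for fs and f :: "'a \<Rightarrow> 'a"
    by (induction fs) auto
  assume "n \<le> m"
  then show ?thesis
    using foldr_comp[of "map S [n..m - 1]" "S m"] by (simp add: comp_seg_def upto_rec2)
qed

lemma module_hom_inv:
  assumes f: "module_hom s s f" and bij: "bij f"
  shows "module_hom s s (inv f)"
proof -
  interpret module_hom s s f by (rule f)
  have f_inv: "f (inv f x) = x" for x
    using bij by (simp add: bij_is_surj surj_f_inv_f)
  have eqI: "x = y" if "f x = f y" for x y
    using that bij by (simp add: bij_is_inj inj_eq)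
  have "inv f (x + y) = inv f x + inv f y" for x y
    by (rule eqI) (simp only: f_inv add)
  moreover have "inv f (s c x) = s c (inv f x)" for c x
    by (rule eqI) (simp only: f_inv scale)
  ultimately show ?thesis
    unfolding module_hom_iff using m1.module_axioms by blast
qed

lemma lp_single:
  assumes "1 \<le> p"
  shows "(\<lambda>i. if i = m then v else 0) \<in> lp_space p"
    "lp_norm p (\<lambda>i. if i = m then v else 0) \<le> norm v"
proof -
  have "(\<Sum>i\<in>F. norm (if i = m then v else 0) powr p) \<le> norm v powr p" if "finite F" for F
  proof -
    have "(\<Sum>i\<in>F. norm (if i = m then v else 0) powr p) = (\<Sum>i\<in>F. if i = m then norm v powr p else 0)"
      by (intro sum.cong) auto
    also have "\<dots> \<le> norm v powr p"
      using that by simp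
    finally show ?thesis .
  qed
  note bound = lp_boundedI[of p "norm v" "\<lambda>i. if i = m then v else 0", OF assms norm_ge_zero this]
  show "(\<lambda>i. if i = m then v else 0) \<in> lp_space p"
    by (rule bound(1))
  show "lp_norm p (\<lambda>i. if i = m then v else 0) \<le> norm v"
    by (rule bound(2))
qed

context lp_shift
begin

text \<open>The fundamental solution, normalized by \<open>G 0 = id\<close>: it conjugates the whole sequence \<open>S\<close> to the
identity, since \<open>S j \<circ> G j = G (j - 1)\<close>, and \<open>G j x\<close> is an unnormalized \<^term>\<open>unit_orbit S j x\<close>.\<close>

definition G :: "int \<Rightarrow> 'a \<Rightarrow> 'a" where
  "G j = (if 0 \<le> j then inv (comp_seg S 1 j) else comp_seg S (j + 1) 0)"

lemma module_hom_comp_seg: "module_hom scl scl (comp_seg S n m)"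
  and bij_comp_seg: "bij (comp_seg S n m)"
proof -
  have S: "module_hom scl scl (S k)" for k
    using invertible[of k] by (simp add: invertible_operator_def linear_iff_module_hom)
  have "module_hom scl scl (foldr (\<circ>) (map S ks) id) \<and> bij (foldr (\<circ>) (map S ks) id)" for ks
  proof (induction ks)
    case Nil
    show ?case
      by (simp add: module_hom_iff module_axioms bij_id[unfolded id_def])
  next
    case (Cons k ks)
    have "bij (S k \<circ> foldr (\<circ>) (map S ks) id)"
      by (rule bij_comp[OF conjunct2[OF Cons.IH] bij_S])
    moreover have "module_hom scl scl (S k \<circ> foldr (\<circ>) (map S ks) id)"
      using S[of k] Cons.IH unfolding module_hom_iff by simp
    moreover have "foldr (\<circ>) (map S (k # ks)) id = S k \<circ> foldr (\<circ>) (map S ks) id"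
      by simp
    ultimately show ?case
      by metis
  qed
  then show "module_hom scl scl (comp_seg S n m)" "bij (comp_seg S n m)"
    by (simp_all add: comp_seg_def)
qed

lemma module_hom_G: "module_hom scl scl (G j)"
  and bij_G: "bij (G j)"
  unfolding G_def
  by (auto intro: module_hom_inv module_hom_comp_seg bij_comp_seg bij_imp_bij_inv)

lemma module_hom_inv_G: "module_hom scl scl (inv (G j))"
  by (intro module_hom_inv module_hom_G bij_G)

lemmas G_simps = module_hom.add[OF module_hom_G] module_hom.scale[OF module_hom_G]
  module_hom.zero[OF module_hom_G] module_hom.sum[OF module_hom_G]
  and inv_G_simps = module_hom.add[OF module_hom_inv_G] module_hom.scale[OF module_hom_inv_G]
  module_hom.zero[OF module_hom_inv_G] module_hom.sum[OF module_hom_inv_G]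

lemma inv_G_G [simp]: "inv (G j) (G j v) = v" "G j (inv (G j) v) = v"
  using bij_G[of j] by (auto simp: bij_def inv_f_f surj_f_inv_f)

lemma S_G: "S j (G j v) = G (j - 1) v"
proof (cases "1 \<le> j")
  case True
  then have "G j = inv (S j) \<circ> inv (comp_seg S 1 (j - 1))"
    by (simp add: G_def comp_seg_last[of 1 j] o_inv_distrib bij_comp_seg bij_S)
  then show ?thesis
    using True by (simp add: G_def)
next
  case False
  then have "G j = comp_seg S (j + 1) 0"
    by (cases "j = 0") (simp_all add: G_def comp_seg_empty inv_id)
  then show ?thesis
    using False by (simp add: G_def comp_seg_first[of j 0])
qed

lemma S_eq: "S j v = G (j - 1) (inv (G j) v)"
  using S_G[of j "inv (G j) v"] by simp

lemma inv_S_eq: "inv (S j) v = G j (inv (G (j - 1)) v)"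
proof -
  have "S j (G j (inv (G (j - 1)) v)) = v"
    by (simp add: S_G)
  then show ?thesis
    by (metis inv_S_S(1))
qed

lemma shift_op_funpow:
  "(shift_op S ^^ k) x j = G j (inv (G (j + int k)) (x (j + int k)))"
proof (induction k arbitrary: j)
  case (Suc k)
  have "(shift_op S ^^ Suc k) x j = S (j + 1) ((shift_op S ^^ k) x (j + 1))"
    by (simp add: shift_op_def)
  then show ?case
    using S_G[of "j + 1"] by (simp add: Suc.IH add_ac)
qed simp

lemma unshift_funpow:
  "(unshift ^^ k) x j = G j (inv (G (j - int k)) (x (j - int k)))"
proof (induction k arbitrary: j)
  case (Suc k)
  have "(unshift ^^ Suc k) x j = inv (S j) ((unshift ^^ k) x (j - 1))"
    by (simp add: unshift_def)
  then show ?case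
    using inv_S_eq[of j "(unshift ^^ k) x (j - 1)"] by (simp add: Suc.IH diff_diff_eq)
qed simp

lemma unit_orbit_eq: "unit_orbit S j x = scl (of_real (inverse (norm (G j x)))) (G j x)"
  unfolding scale_of_real unit_orbit_def G_def by simp

end

locale lp_shift_basis = lp_shift scl p S C0
  for scl :: "'k::real_or_complex \<Rightarrow> 'a::banach \<Rightarrow> 'a" and p S C0 +
  fixes E :: "'a set"
  assumes finite_E: "finite E" and basis_E: "is_basis scl E"
    and bounded_projections: "has_bounded_projections scl S E"
begin

lemma independent_E: "independent E" and span_E: "span E = UNIV"
  using basis_E by (auto simp: is_basis_def)

text \<open>Coordinates with respect to the basis \<open>G j b\<close> rather than its normalization: \<open>S\<close> preserves these
coordinates, so all growth sits in the numbers \<open>norm (G j b)\<close>.\<close>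

definition coord :: "int \<Rightarrow> 'a \<Rightarrow> 'a \<Rightarrow> 'k" where
  "coord j b v = representation E (inv (G j) v) b"

definition proj :: "int \<Rightarrow> 'a \<Rightarrow> 'a \<Rightarrow> 'a" where
  "proj j b v = scl (coord j b v) (G j b)"

lemma coord_add: "coord j b (v + w) = coord j b v + coord j b w"
  and coord_scale: "coord j b (scl c v) = c * coord j b v"
  by (simp_all add: coord_def inv_G_simps representation_add representation_scale
      independent_E span_E)

lemma coord_0 [simp]: "coord j b 0 = 0"
  using coord_add[of j b 0 0] by simp

lemma coord_G: "b \<in> E \<Longrightarrow> c \<in> E \<Longrightarrow> coord j b (G j c) = (if b = c then 1 else 0)"
  by (simp add: coord_def representation_basis independent_E)

lemma coord_transport: "coord j b (G j (inv (G i) v)) = coord i b v"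
  by (simp add: coord_def)

lemma coord_S: "coord (j - 1) b (S j v) = coord j b v"
  unfolding S_eq[of j v] by (rule coord_transport)

lemma module_hom_proj: "module_hom scl scl (proj j b)"
  by (simp add: module_hom_iff module_axioms proj_def coord_add coord_scale scale_left_distrib)

lemma sum_proj: "(\<Sum>b\<in>E. proj j b v) = v"
proof -
  have "(\<Sum>b\<in>E. proj j b v) = G j (\<Sum>b\<in>E. scl (coord j b v) b)"
    by (simp add: proj_def G_simps)
  also have "(\<Sum>b\<in>E. scl (coord j b v) b) = inv (G j) v"
    unfolding coord_def by (rule sum_representation_eq) (auto simp: independent_E span_E finite_E)
  finally show ?thesis
    by simp
qed

lemma proj_proj: "b \<in> E \<Longrightarrow> c \<in> E \<Longrightarrow> proj j b (proj j c v) = (if b = c then proj j c v else 0)"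
  by (simp add: proj_def coord_scale coord_G)

lemma proj_transport: "proj j b (G j (inv (G i) v)) = G j (inv (G i) (proj i b v))"
  by (simp add: proj_def coord_transport inv_G_simps G_simps)

lemma norm_G_pos: "b \<in> E \<Longrightarrow> 0 < norm (G j b)"
proof -
  assume "b \<in> E"
  then have "b \<noteq> 0"
    using independent_E dependent_zero by blast
  then have "G j b \<noteq> 0"
    using inv_G_G(1)[of j b] inv_G_simps(3) by metis
  then show ?thesis
    by simp
qed

lemma norm_proj: "norm (proj j b v) = norm (coord j b v) * norm (G j b)"
  by (simp add: proj_def norm_scale)

lemma coord_unit_orbit:
  assumes "b \<in> E" "c \<in> E"
  shows "coord j b (unit_orbit S j c) = (if b = c then of_real (1 / norm (G j c)) else 0)"
  using assms by (simp add: unit_orbit_eq coord_scale coord_G inverse_eq_divide)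

lemma inj_on_unit_orbit: "inj_on (unit_orbit S j) E"
proof (rule inj_onI, rule ccontr)
  fix b c assume bc: "b \<in> E" "c \<in> E" "unit_orbit S j b = unit_orbit S j c" "b \<noteq> c"
  then have "of_real (1 / norm (G j b)) = (0 :: 'k)"
    using coord_unit_orbit[of b b j] coord_unit_orbit[of b c j] by simp
  then show False
    using bc norm_G_pos[of b j] by (simp only: of_real_eq_0_iff) simp
qed

text \<open>The functional \<open>coord j b\<close> vanishes on every other vector of the transported basis, hence on their
span, but not at \<open>b\<close>'s own vector.\<close>

lemma independent_basis_at: "independent (basis_at S E j)"
proof
  assume "dependent (basis_at S E j)"
  then obtain b where b: "b \<in> E"
    and span: "unit_orbit S j b \<in> span (basis_at S E j - {unit_orbit S j b})"
    unfolding dependent_def basis_at_def by blast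
  have "coord j b v = 0" if "v \<in> span (basis_at S E j - {unit_orbit S j b})" for v
    using that
  proof (induction rule: span_induct_alt)
    case (step c x y)
    then obtain d where d: "d \<in> E" "x = unit_orbit S j d" "d \<noteq> b"
      unfolding basis_at_def by blast
    then show ?case
      using step b by (simp add: coord_add coord_scale coord_unit_orbit)
  qed simp
  then have "coord j b (unit_orbit S j b) = 0"
    using span by blast
  then show False
    using b norm_G_pos[of b j] by (simp add: coord_unit_orbit)
qed

lemma proj_eq_scale_unit_orbit:
  assumes "b \<in> E"
  shows "proj j b v = scl (coord j b v * of_real (norm (G j b))) (unit_orbit S j b)"
proof -
  have "norm (G j b) \<noteq> 0"
    using norm_G_pos[OF assms, of j] by simp
  then show ?thesis
    by (simp add: unit_orbit_eq proj_def of_real_mult[symmetric] mult.assoc del: of_real_mult)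
qed

lemma span_basis_at: "span (basis_at S E j) = UNIV"
proof -
  have "(\<Sum>b\<in>E. proj j b v) \<in> span (basis_at S E j)" for v
  proof (rule span_sum)
    fix b assume "b \<in> E"
    then show "proj j b v \<in> span (basis_at S E j)"
      unfolding proj_eq_scale_unit_orbit[OF \<open>b \<in> E\<close>] basis_at_def
      by (intro span_scale span_base imageI)
  qed
  then show ?thesis
    by (auto simp: sum_proj)
qed

text \<open>Links the conjugated projections to the given ones, so that the hypothesis on bounded projections
applies to \<open>proj\<close>.\<close>

lemma basis_proj_eq_proj:
  assumes b: "b \<in> E"
  shows "basis_proj scl (basis_at S E j) (unit_orbit S j b) = proj j b"
proof
  fix v
  let ?B = "basis_at S E j" and ?e = "unit_orbit S j"
  let ?a = "\<lambda>c. coord j c v * of_real (norm (G j c))"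
  have "representation ?B v (?e b) = representation ?B (\<Sum>c\<in>E. scl (?a c) (?e c)) (?e b)"
    using sum_proj[of j v] by (simp add: proj_eq_scale_unit_orbit)
  also have "\<dots> = (\<Sum>c\<in>E. ?a c * (if ?e b = ?e c then 1 else 0))"
  proof -
    have "representation ?B (?e c) (?e b) = (if ?e b = ?e c then 1 else 0)" if "c \<in> E" for c
      using that by (subst representation_basis[OF independent_basis_at]) (auto simp: basis_at_def)
    then show ?thesis
      by (simp add: representation_sum representation_scale independent_basis_at span_basis_at)
  qed
  also have "\<dots> = (\<Sum>c\<in>E. if c = b then ?a c else 0)"
    using b inj_on_unit_orbit[of j] by (intro sum.cong) (auto dest: inj_onD)
  also have "\<dots> = ?a b"
    using b finite_E by simp
  finally show "basis_proj scl ?B (?e b) v = proj j b v"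
    by (simp add: basis_proj_def proj_eq_scale_unit_orbit b)
qed

lemma bounded_linear_proj: "b \<in> E \<Longrightarrow> bounded_linear (proj j b)"
  using bounded_projections basis_proj_eq_proj[of b j]
  unfolding has_bounded_projections_def basis_at_def by (metis imageI)

lemma proj_bounded:
  obtains B where "0 < B" "\<And>j b v. b \<in> E \<Longrightarrow> norm (proj j b v) \<le> B * norm v"
proof -
  obtain B where "\<forall>j. \<forall>b\<in>basis_at S E j. onorm (basis_proj scl (basis_at S E j) b) \<le> B"
    using bounded_projections unfolding has_bounded_projections_def by blast
  then have B: "onorm (proj j b) \<le> B" if "b \<in> E" for j b
    using basis_proj_eq_proj[OF that, of j] that unfolding basis_at_def by (metis imageI)
  have "norm (proj j b v) \<le> max B 1 * norm v" if "b \<in> E" for j b v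
  proof -
    have "norm (proj j b v) \<le> onorm (proj j b) * norm v"
      by (intro onorm bounded_linear_proj that)
    also have "\<dots> \<le> max B 1 * norm v"
      using B[OF that, of j] by (intro mult_right_mono) auto
    finally show ?thesis .
  qed
  then show ?thesis
    using that[of "max B 1"] by simp
qed


section \<open>Shadowing yields a splitting\<close>

text \<open>The error at time \<open>n\<close> is the unit vector along the orbit of \<open>b\<close>, placed at position \<open>- n - 1\<close>, so
that it meets the solution entry \<open>x n (- n)\<close> moved there by the shift. The entries
\<open>y j = x (- j) j\<close> therefore satisfy a closed equation, whose \<open>b\<close>-coordinates have increments
\<open>1 / norm (G (j - 1) b)\<close>; the bounded projections bound them. Passing to real parts makes
the sign of the coordinate available.\<close>

proposition shadowing_imp_dichotomy:
  assumes shadowing: "shadowing_property (lp_space p) (lp_norm p) (shift_op S)"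
  shows "\<exists>P C \<theta>. 0 < C \<and> 0 < \<theta> \<and> \<theta> < 1 \<and>
    (\<forall>b\<in>E. dichotomous (P b) C \<theta> (\<lambda>j. norm (G j b)))"
proof -
  obtain K where K: "0 < K" and shadow: "\<And>z. bounded_seq_in (lp_space p) (lp_norm p) z \<Longrightarrow>
      \<exists>x. bounded_seq_in (lp_space p) (lp_norm p) x \<and> (\<forall>n. x (n + 1) - shift_op S (x n) = z n) \<and>
        (SUP n. lp_norm p (x n)) \<le> K * (SUP n. lp_norm p (z n))"
    using shadowing unfolding shadowing_property_def by blast
  obtain B where B: "0 < B" "\<And>j b v. b \<in> E \<Longrightarrow> norm (proj j b v) \<le> B * norm v"
    by (rule proj_bounded) (rule that)
  obtain \<rho> :: "'k \<Rightarrow> real" where \<rho>: "\<And>a b. \<rho> (a - b) = \<rho> a - \<rho> b" "\<And>r. \<rho> (of_real r) = r"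
    "\<And>a. \<bar>\<rho> a\<bar> \<le> norm a"
    by (rule real_part_functional) (rule that)
  have u_exists: "\<exists>u. bounded_solution C0 (B * K) (\<lambda>j. norm (G j b)) u" if b: "b \<in> E" for b
  proof -
    define z :: "int \<Rightarrow> int \<Rightarrow> 'a"
      where "z n = (\<lambda>i. if i = - n - 1 then unit_orbit S (- n - 1) b else 0)" for n
    have "norm (unit_orbit S j b) = 1" for j
      using norm_G_pos[OF b, of j] by (simp add: unit_orbit_eq norm_scale norm_inverse)
    then have z: "z n \<in> lp_space p" "lp_norm p (z n) \<le> 1" for n
      using lp_single[OF p_ge_1, of "- n - 1" "unit_orbit S (- n - 1) b"] by (simp_all add: z_def)
    then have "bounded_seq_in (lp_space p) (lp_norm p) z"
      by (auto simp: bounded_seq_in_def intro!: bdd_aboveI[of _ 1])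
    then obtain x where x: "bounded_seq_in (lp_space p) (lp_norm p) x"
      and eq: "\<And>n. x (n + 1) - shift_op S (x n) = z n"
      and SUP: "(SUP n. lp_norm p (x n)) \<le> K * (SUP n. lp_norm p (z n))"
      using shadow by blast
    have x_lp: "x n \<in> lp_space p" for n
      using x by (auto simp: bounded_seq_in_def)
    have x_le: "lp_norm p (x n) \<le> K" for n
    proof -
      have "lp_norm p (x n) \<le> (SUP n. lp_norm p (x n))"
        using x by (intro cSUP_upper) (auto simp: bounded_seq_in_def)
      also have "\<dots> \<le> K * (SUP n. lp_norm p (z n))"
        by (rule SUP)
      also have "\<dots> \<le> K * 1"
        using K z(2) by (intro mult_left_mono cSUP_least) auto
      finally show ?thesis
        by simp
    qed
    define y where "y j = x (- j) j" for j
    have y_le: "norm (y j) \<le> K" for j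
      using norm_le_lp_norm[OF p_ge_1 x_lp, of "- j" j] x_le[of "- j"] by (simp add: y_def)
    have y_step: "y (j - 1) = S j (y j) + unit_orbit S (j - 1) b" for j
    proof -
      have "(x (- j + 1) - shift_op S (x (- j))) (j - 1) = z (- j) (j - 1)"
        by (simp only: eq)
      then show ?thesis
        by (simp add: y_def z_def shift_op_def algebra_simps)
    qed
    define u where "u j = \<rho> (coord j b (y j))" for j
    have "u (j - 1) - u j = 1 / norm (G (j - 1) b)" for j
    proof -
      have "coord (j - 1) b (y (j - 1)) - coord j b (y j) = of_real (1 / norm (G (j - 1) b))"
        using b by (simp add: y_step coord_add coord_S coord_unit_orbit)
      then show ?thesis
        unfolding u_def by (metis \<rho>(1,2))
    qed
    moreover have "\<bar>u j\<bar> * norm (G j b) \<le> B * K" for j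
    proof -
      have "\<bar>u j\<bar> * norm (G j b) \<le> norm (proj j b (y j))"
        unfolding norm_proj u_def by (intro mult_right_mono \<rho>) auto
      also have "\<dots> \<le> B * norm (y j)"
        by (rule B(2)[OF b])
      also have "\<dots> \<le> B * K"
        using B(1) y_le by (intro mult_left_mono) auto
      finally show ?thesis .
    qed
    moreover have "norm (G (j - 1) b) \<le> C0 * norm (G j b)" for j
      using norm_S(1)[of j "G j b"] by (simp add: S_G)
    ultimately have "bounded_solution C0 (B * K) (\<lambda>j. norm (G j b)) u"
      using norm_G_pos[OF b] by (simp add: bounded_solution_def)
    then show ?thesis
      by blast
  qed
  obtain C \<theta> where C: "0 < C \<and> 0 < \<theta> \<and> \<theta> < 1 \<and>
      (\<forall>g u. bounded_solution C0 (B * K) g u \<longrightarrow> (\<exists>P. dichotomous P C \<theta> g))"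
    using scalar_dichotomy[OF C0_pos mult_pos_pos[OF B(1) K]] by (elim exE) (rule that)
  then have "\<forall>b\<in>E. \<exists>P. dichotomous P C \<theta> (\<lambda>j. norm (G j b))"
    using u_exists by blast
  then obtain P where "\<forall>b\<in>E. dichotomous (P b) C \<theta> (\<lambda>j. norm (G j b))"
    by (rule bchoice[THEN exE])
  then show ?thesis
    using C by (intro exI[of _ P] exI[of _ C] exI[of _ \<theta>]) blast
qed

text \<open>Both subspaces of the splitting have this form, for a family \<open>Q\<close> of sets of positions and for
the family of their complements.\<close>

definition supported_in :: "('a \<Rightarrow> int set) \<Rightarrow> (int \<Rightarrow> 'a) set" where
  "supported_in Q = {x \<in> lp_space p. \<forall>j. \<forall>b\<in>E. j \<notin> Q b \<longrightarrow> proj j b (x j) = 0}"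

lemma closed_subspace_supported_in:
  "closed_subspace (seq_scale scl) (lp_space p) (lp_norm p) (supported_in Q)"
  unfolding closed_subspace_def
proof
  show "seq.subspace (supported_in Q)"
  proof (rule seq.subspaceI)
    fix c x assume x: "x \<in> supported_in Q"
    have "seq_scale scl c x \<in> lp_space p"
      using lp_norm_dominated(1)[of p "norm c" id x "seq_scale scl c x"] p_ge_1 x
      by (simp add: seq_scale_def norm_scale supported_in_def)
    then show "seq_scale scl c x \<in> supported_in Q"
      using x by (simp add: supported_in_def seq_scale_def module_hom.scale[OF module_hom_proj])
  next
    fix x y assume xy: "x \<in> supported_in Q" "y \<in> supported_in Q"
    then have "x + y \<in> lp_space p"
      by (intro lp_add p_ge_1) (auto simp: supported_in_def)
    then show "x + y \<in> supported_in Q"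
      using xy unfolding supported_in_def by (simp add: module_hom.add[OF module_hom_proj])
  qed (simp add: supported_in_def module_hom.zero[OF module_hom_proj])
  show "closedin lp.mtopology (supported_in Q)"
    unfolding lp.metric_closedin_iff_sequentially_closed
  proof (intro conjI allI impI)
    show "supported_in Q \<subseteq> lp_space p"
      by (auto simp: supported_in_def)
    fix \<sigma> l assume *: "range \<sigma> \<subseteq> supported_in Q \<and> limitin lp.mtopology \<sigma> l sequentially"
    then have \<sigma>: "\<sigma> n \<in> supported_in Q" for n
      by blast
    then have \<sigma>_lp: "\<sigma> n \<in> lp_space p" for n
      by (simp add: supported_in_def)
    have l: "l \<in> lp_space p" and lim: "(\<lambda>n. lp_norm p (\<sigma> n - l)) \<longlonglongrightarrow> 0"
      using * by (simp_all add: lp.limitin_metric_dist_null)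
    have "proj j b (l j) = 0" if b: "b \<in> E" "j \<notin> Q b" for j b
    proof -
      have "norm (\<sigma> n j - l j) \<le> lp_norm p (\<sigma> n - l)" for n
        by (intro norm_diff_le_lp_norm \<sigma>_lp l)
      then have "(\<lambda>n. \<sigma> n j - l j) \<longlonglongrightarrow> 0"
        by (intro Lim_null_comparison[OF _ lim]) simp
      then have "(\<lambda>n. \<sigma> n j) \<longlonglongrightarrow> l j"
        by (rule LIM_zero_cancel)
      moreover have "bounded_linear (proj j b)"
        by (rule bounded_linear_proj[OF b(1)])
      ultimately have "(\<lambda>n. proj j b (\<sigma> n j)) \<longlonglongrightarrow> proj j b (l j)"
        by (rule bounded_linear.tendsto[rotated])
      moreover have "proj j b (\<sigma> n j) = 0" for n
        using \<sigma>[of n] b by (simp add: supported_in_def)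
      ultimately show ?thesis
        by (simp add: LIMSEQ_const_iff)
    qed
    then show "l \<in> supported_in Q"
      using l by (simp add: supported_in_def)
  qed
qed

lemma supported_in_complement:
  "supported_in Q \<inter> supported_in (\<lambda>b. - Q b) = {0}"
  "{u + v |u v. u \<in> supported_in Q \<and> v \<in> supported_in (\<lambda>b. - Q b)} = lp_space p"
proof -
  have "x = 0" if "x \<in> supported_in Q" "x \<in> supported_in (\<lambda>b. - Q b)" for x
  proof
    fix j
    have "proj j b (x j) = 0" if "b \<in> E" for b
      using \<open>x \<in> supported_in Q\<close> \<open>x \<in> supported_in (\<lambda>b. - Q b)\<close> that
      by (cases "j \<in> Q b") (auto simp: supported_in_def)
    then show "x j = 0 j"
      using sum_proj[of j "x j"] by simp
  qed
  moreover have "0 \<in> supported_in R" for R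
    using closed_subspaceD(1)[OF closed_subspace_supported_in] by (rule seq.subspace_0)
  ultimately show "supported_in Q \<inter> supported_in (\<lambda>b. - Q b) = {0}"
    by blast
  obtain B where B: "0 < B" "\<And>j b v. b \<in> E \<Longrightarrow> norm (proj j b v) \<le> B * norm v"
    by (rule proj_bounded) (rule that)
  have "\<exists>u v. x = u + v \<and> u \<in> supported_in Q \<and> v \<in> supported_in (\<lambda>b. - Q b)"
    if x: "x \<in> lp_space p" for x
  proof -
    define part where "part R = (\<lambda>j. \<Sum>b\<in>E. if j \<in> R b then proj j b (x j) else 0)"
      for R :: "'a \<Rightarrow> int set"
    have part: "part R \<in> supported_in R" for R
    proof -
      have "norm (part R j) \<le> real (card E) * B * norm (x j)" for j
      proof -
        have "norm (part R j) \<le> (\<Sum>b\<in>E. B * norm (x j))"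
          unfolding part_def using B by (intro sum_norm_le) auto
        then show ?thesis
          by simp
      qed
      then have "part R \<in> lp_space p"
        using lp_norm_dominated(1)[OF p_ge_1 _ inj_on_id x, of "real (card E) * B" "part R"] B(1)
        by simp
      moreover have "proj j b (part R j) = 0" if "b \<in> E" "j \<notin> R b" for j b
      proof -
        have "proj j b (part R j) = (\<Sum>c\<in>E. proj j b (if j \<in> R c then proj j c (x j) else 0))"
          unfolding part_def by (rule module_hom.sum[OF module_hom_proj])
        also have "\<dots> = 0"
          using that
          by (intro sum.neutral) (auto simp: proj_proj module_hom.zero[OF module_hom_proj])
        finally show ?thesis .
      qed
      ultimately show ?thesis
        by (simp add: supported_in_def)
    qed
    have "x = part Q + part (\<lambda>b. - Q b)"
    proof
      fix j
      have "part Q j + part (\<lambda>b. - Q b) j = (\<Sum>b\<in>E. proj j b (x j))"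
        unfolding part_def by (subst sum.distrib[symmetric], intro sum.cong) auto
      then show "x j = (part Q + part (\<lambda>b. - Q b)) j"
        by (simp add: sum_proj)
    qed
    then show ?thesis
      using part by blast
  qed
  moreover have "u + v \<in> lp_space p" if "u \<in> supported_in Q" "v \<in> supported_in (\<lambda>b. - Q b)" for u v
    using that by (intro lp_add p_ge_1) (auto simp: supported_in_def)
  ultimately show "{u + v |u v. u \<in> supported_in Q \<and> v \<in> supported_in (\<lambda>b. - Q b)} = lp_space p"
    by blast
qed

text \<open>Powers of the shift and of its inverse carry the entry at \<open>\<tau> j\<close> to position \<open>j\<close> by
\<open>G j \<circ> inv (G (\<tau> j))\<close>, which multiplies the norm of the \<open>b\<close>-component by
\<open>norm (G j b) / norm (G (\<tau> j) b)\<close>. Hence growth bounds for the basis vectors, on the positions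
that matter, are operator norm bounds up to the constant \<open>card E * B\<close>.\<close>

lemma lp_norm_transport:
  assumes B: "0 \<le> B" "\<And>j b v. b \<in> E \<Longrightarrow> norm (proj j b v) \<le> B * norm v"
    and x: "x \<in> supported_in Q" and \<tau>: "inj \<tau>" and D: "0 \<le> D"
    and growth: "\<And>b j. b \<in> E \<Longrightarrow> \<tau> j \<in> Q b \<Longrightarrow> norm (G j b) \<le> D * norm (G (\<tau> j) b)"
  shows "lp_norm p (\<lambda>j. G j (inv (G (\<tau> j)) (x (\<tau> j)))) \<le> real (card E) * (D * B) * lp_norm p x"
proof (rule lp_norm_dominated(2)[OF p_ge_1 _ \<tau>])
  fix j
  let ?y = "G j (inv (G (\<tau> j)) (x (\<tau> j)))"
  have "norm (proj j b ?y) \<le> D * B * norm (x (\<tau> j))" if b: "b \<in> E" for b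
  proof (cases "\<tau> j \<in> Q b")
    case True
    have "norm (proj j b ?y) = norm (coord (\<tau> j) b (x (\<tau> j))) * norm (G j b)"
      by (simp add: norm_proj coord_transport)
    also have "\<dots> \<le> norm (coord (\<tau> j) b (x (\<tau> j))) * (D * norm (G (\<tau> j) b))"
      by (intro mult_left_mono growth b True) auto
    also have "\<dots> = D * norm (proj (\<tau> j) b (x (\<tau> j)))"
      by (simp add: norm_proj)
    also have "\<dots> \<le> D * (B * norm (x (\<tau> j)))"
      by (intro mult_left_mono B b D)
    finally show ?thesis
      by simp
  next
    case False
    then have "proj j b ?y = 0"
      using x b by (simp add: proj_transport supported_in_def inv_G_simps G_simps)
    then show ?thesis
      using B(1) D by simp
  qed
  then have "norm (\<Sum>b\<in>E. proj j b ?y) \<le> (\<Sum>b\<in>E. D * B * norm (x (\<tau> j)))"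
    by (intro sum_norm_le)
  then show "norm ?y \<le> real (card E) * (D * B) * norm (x (\<tau> j))"
    by (simp add: sum_proj)
qed (use B D x in \<open>auto simp: supported_in_def\<close>)

text \<open>Invariance of the two subspaces is the left-closedness of the sets \<open>P b\<close>; the decay on them is the
two halves of the dichotomy.\<close>

proposition shadowing_imp_splitting:
  assumes shadowing: "shadowing_property (lp_space p) (lp_norm p) (shift_op S)"
  shows "\<exists>M N C \<theta>. exponential_splitting M N C \<theta>"
proof -
  obtain P C \<theta> where all: "0 < C \<and> 0 < \<theta> \<and> \<theta> < 1 \<and>
      (\<forall>b\<in>E. dichotomous (P b) C \<theta> (\<lambda>j. norm (G j b)))"
    using shadowing_imp_dichotomy[OF shadowing] by (elim exE) (rule that)
  then have C: "0 < C" and \<theta>: "0 < \<theta>" "\<theta> < 1"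
    by blast+
  have down: "j - 1 \<in> P b" if "b \<in> E" "j \<in> P b" for b j
    using all that by (simp add: dichotomous_def)
  have contract: "norm (G (j - int k) b) \<le> C * \<theta> ^ k * norm (G j b)"
    if "b \<in> E" "j \<in> P b" for b j k
    using all that by (simp add: dichotomous_def)
  have expand: "norm (G (j + int k) b) \<le> C * \<theta> ^ k * norm (G j b)"
    if "b \<in> E" "j \<notin> P b" for b j k
    using all that by (simp add: dichotomous_def)
  obtain B where B: "0 < B" "\<And>j b v. b \<in> E \<Longrightarrow> norm (proj j b v) \<le> B * norm v"
    by (rule proj_bounded) (rule that)
  define M N where "M = supported_in P" and "N = supported_in (\<lambda>b. - P b)"
  \<comment> \<open>One more than the cardinality, so that the constant is positive even for the zero space.\<close>
  define C' where "C' = (real (card E) + 1) * (C * B)"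
  have "0 < C'"
    using C B by (simp add: C'_def add_nonneg_pos)
  have C': "real (card E) * (C * \<theta> ^ n * B) * lp_norm p x \<le> C' * \<theta> ^ n * lp_norm p x"
    for n and x :: "int \<Rightarrow> 'a"
  proof -
    have "real (card E) * (C * B * \<theta> ^ n * lp_norm p x)
        \<le> (real (card E) + 1) * (C * B * \<theta> ^ n * lp_norm p x)"
      using C B \<theta> by (intro mult_right_mono) (auto simp: lp_norm_nonneg)
    then show ?thesis
      by (simp add: C'_def mult_ac)
  qed
  have "shift_op S x \<in> M" if x: "x \<in> M" for x
  proof -
    have "proj j b (shift_op S x j) = 0" if b: "b \<in> E" "j \<notin> P b" for j b
    proof -
      have "j + 1 \<notin> P b"
        using down[OF b(1), of "j + 1"] b(2) by auto
      then have "proj (j + 1) b (x (j + 1)) = 0"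
        using x b by (simp add: M_def supported_in_def)
      then show ?thesis
        using coord_S[of "j + 1" b "x (j + 1)"] norm_G_pos[OF b(1)]
        by (simp add: shift_op_def proj_def)
    qed
    then show ?thesis
      using x shift_op_lp(1) by (simp add: M_def supported_in_def)
  qed
  moreover have "unshift x \<in> N" if x: "x \<in> N" for x
  proof -
    have "proj j b (unshift x j) = 0" if b: "b \<in> E" "j \<in> P b" for j b
    proof -
      have "proj (j - 1) b (x (j - 1)) = 0"
        using x b down[OF b] by (simp add: N_def supported_in_def)
      then show ?thesis
        using coord_S[of j b "inv (S j) (x (j - 1))"] norm_G_pos[OF b(1)]
        by (simp add: unshift_def proj_def)
    qed
    then show ?thesis
      using x unshift_lp(1) by (simp add: N_def supported_in_def)
  qed
  moreover have "lp_norm p ((shift_op S ^^ n) x) \<le> C' * \<theta> ^ n * lp_norm p x" if "x \<in> M" for n x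
  proof -
    have "(shift_op S ^^ n) x = (\<lambda>j. G j (inv (G (j + int n)) (x (j + int n))))"
      by (simp add: fun_eq_iff shift_op_funpow)
    moreover have "norm (G j b) \<le> C * \<theta> ^ n * norm (G (j + int n) b)"
      if "b \<in> E" "j + int n \<in> P b" for b j
      using contract[OF that, of n] by simp
    ultimately have "lp_norm p ((shift_op S ^^ n) x) \<le> real (card E) * (C * \<theta> ^ n * B) * lp_norm p x"
      using lp_norm_transport[of B x P "\<lambda>j. j + int n" "C * \<theta> ^ n"] B C \<theta> that
      by (simp add: M_def inj_def)
    then show ?thesis
      using C' by (rule order_trans)
  qed
  moreover have "lp_norm p ((unshift ^^ n) x) \<le> C' * \<theta> ^ n * lp_norm p x" if "x \<in> N" for n x
  proof -
    have "(unshift ^^ n) x = (\<lambda>j. G j (inv (G (j - int n)) (x (j - int n))))"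
      by (simp add: fun_eq_iff unshift_funpow)
    moreover have "norm (G j b) \<le> C * \<theta> ^ n * norm (G (j - int n) b)"
      if "b \<in> E" "j - int n \<notin> P b" for b j
      using expand[OF that, of n] by simp
    ultimately have "lp_norm p ((unshift ^^ n) x) \<le> real (card E) * (C * \<theta> ^ n * B) * lp_norm p x"
      using lp_norm_transport[of B x "\<lambda>b. - P b" "\<lambda>j. j - int n" "C * \<theta> ^ n"] B C \<theta> that
      by (simp add: N_def inj_def)
    then show ?thesis
      using C' by (rule order_trans)
  qed
  ultimately have "exponential_splitting M N C' \<theta>"
    using supported_in_complement[of P] \<open>0 < C'\<close> \<theta>
    unfolding exponential_splitting_def
    by (auto simp: M_def N_def closed_subspace_supported_in)
  then show ?thesis
    by blast
qed

end

theorem corollary2p16: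
  fixes p C0 :: real
    and scl :: "'k::real_or_complex \<Rightarrow> 'a::banach \<Rightarrow> 'a"
    and S :: "int \<Rightarrow> 'a \<Rightarrow> 'a"
    and E :: "'a set"
  assumes "1 \<le> p"
    and "normed_space_over scl"
    and "finite_dimensional scl"
    and "\<And>n. invertible_operator scl (S n)"
    and "C0 > 0"
    and "\<And>n. onorm (S n) < C0 \<and> onorm (inv (S n)) < C0"
    and "is_basis scl E"
    and "has_bounded_projections scl S E"
  shows "generalized_hyperbolic (seq_scale scl) (lp_space p) (lp_norm p) (shift_op S) \<longleftrightarrow>
         shadowing_property (lp_space p) (lp_norm p) (shift_op S)"
proof -
  interpret normed_space_over scl by (rule assms(2))
  obtain B where "finite B" "span B = UNIV"
    using assms(3) by (auto simp: finite_dimensional_def)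
  then have "finite E"
    using independent_span_bound[of B E] assms(7) by (auto simp: is_basis_def)
  then interpret lp_shift_basis scl p S C0 E
    using assms by unfold_locales auto
  show ?thesis
    using generalized_hyperbolic_iff_splitting exponential_splitting_imp_shadowing
      shadowing_imp_splitting by blast
qed

end
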